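(* Let $\Omega\subset\mathbb{C}^2$ be a bounded convex Reinhardt domain. Suppose $\Gamma_1\neq\emptyset$ and $\Gamma_2\neq\emptyset$. Let $f\in A^2(\Omega)$ be such that the Hankel operator $H_{\overline{f}}$ is compact on $A^2(\Omega)$. Then there exists $c\in\mathbb{C}$ such that $f\equiv c$.
   Context: A domain $\Omega\subset\mathbb{C}^2$ is Reinhardt if $(\zeta_1z_1,\zeta_2z_2)\in\Omega$ whenever $(z_1,z_2)\in\Omega$ and $|\zeta_1|=|\zeta_2|=1$. $A^2(\Omega)$ is the Bergman space of holomorphic functions on $\Omega$ that are square integrable with respect to Lebesgue measure, a closed subspace of $L^2(\Omega)$, and $P:L^2(\Omega)\to A^2(\Omega)$ is the orthogonal (Bergman) projection. For a symbol $\phi\in L^2(\Omega)$, the Hankel operator is $H_\phi g=(I-P)(\phi g)$, a priori defined for those $g\in A^2(\Omega)$ with $\phi g\in L^2(\Omega)$, so possibly only densely defined; saying that $H_\phi$ is compact on $A^2(\Omega)$ includes that it is defined (by extension) on all of $A^2(\Omega)$ as a compact operator into $L^2(\Omega)$. Notation: $\mathbb{D}_r=\{z\in\mathbb{C}:|z|<r\}$, $\mathbb{D}=\mathbb{D}_1$, $S_t=\{z\in\mathbb{C}:|z|=t\}$, and $b\Omega$ is the boundary of $\Omega$. Define $$\Gamma_\Omega=\overline{\bigcup\{\phi(\mathbb{D}) : \phi:\mathbb{D}\to b\Omega \text{ holomorphic and non-trivial (i.e. non-constant)}\}}.$$ For a bounded convex Reinhardt domain in $\mathbb{C}^2$ it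 is known that $\Gamma_\Omega=\Gamma_1\cup\Gamma_2$, where either $\Gamma_1=\emptyset$ or $\Gamma_1=\overline{\mathbb{D}_{r_1}}\times S_{s_1}$, and either $\Gamma_2=\emptyset$ or $\Gamma_2=S_{s_2}\times\overline{\mathbb{D}_{r_2}}$, for some $r_1,r_2,s_1,s_2>0$; this defines $\Gamma_1$ and $\Gamma_2$. *)

theory Defs
  imports "HOL-Complex_Analysis.Complex_Analysis"
begin

definition reinhardt_domain :: "(complex \<times> complex) set \<Rightarrow> bool" where
  "reinhardt_domain \<Omega> \<longleftrightarrow>
     open \<Omega> \<and> connected \<Omega> \<and> \<Omega> \<noteq> {} \<and>
     (\<forall>z1 z2 \<zeta>1 \<zeta>2. (z1, z2) \<in> \<Omega> \<and> cmod \<zeta>1 = 1 \<and> cmod \<zeta>2 = 1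
        \<longrightarrow> (\<zeta>1 * z1, \<zeta>2 * z2) \<in> \<Omega>)"

text \<open>Complex differentiability in two variables: at every point the Frechet derivative exists
  and is complex linear. Meant for open sets.\<close>

definition holomorphic2_on ::
    "(complex \<times> complex \<Rightarrow> complex) \<Rightarrow> (complex \<times> complex) set \<Rightarrow> bool" where
  "holomorphic2_on f \<Omega> \<longleftrightarrow>
     (\<forall>z\<in>\<Omega>. \<exists>a b. (f has_derivative (\<lambda>(h1, h2). a * h1 + b * h2)) (at z))"

text \<open>Elements of the function spaces below are total functions of which only the values on
  \<open>\<Omega>\<close> matter. Equality in \<open>L2 \<Omega>\<close> is equality almost everywhere on \<open>\<Omega>\<close>.\<close>

definition L2 :: "(complex \<times> complex) set \<Rightarrow> (complex \<times> complex \<Rightarrow> complex) set" where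
  "L2 \<Omega> = {f. f \<in> borel_measurable (lebesgue_on \<Omega>) \<and>
               integrable (lebesgue_on \<Omega>) (\<lambda>z. (cmod (f z))\<^sup>2)}"

definition L2_norm :: "(complex \<times> complex) set \<Rightarrow> (complex \<times> complex \<Rightarrow> complex) \<Rightarrow> real" where
  "L2_norm \<Omega> f = sqrt (LINT z|lebesgue_on \<Omega>. (cmod (f z))\<^sup>2)"

definition L2_inner ::
    "(complex \<times> complex) set \<Rightarrow> (complex \<times> complex \<Rightarrow> complex)
      \<Rightarrow> (complex \<times> complex \<Rightarrow> complex) \<Rightarrow> complex" where
  "L2_inner \<Omega> f g = (LINT z|lebesgue_on \<Omega>. f z * cnj (g z))"

definition bergman_space ::
    "(complex \<times> complex) set \<Rightarrow> (complex \<times> complex \<Rightarrow> complex) set" where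
  "bergman_space \<Omega> = {f. holomorphic2_on f \<Omega> \<and> f \<in> L2 \<Omega>}"

text \<open>The orthogonal projection of \<open>L2 \<Omega>\<close> onto its closed subspace \<open>bergman_space \<Omega>\<close>. For open
  \<open>\<Omega>\<close> and \<open>u \<in> L2 \<Omega>\<close> the chosen function exists and its values on \<open>\<Omega>\<close> are unique.\<close>

definition bergman_projection ::
    "(complex \<times> complex) set \<Rightarrow> (complex \<times> complex \<Rightarrow> complex) \<Rightarrow> complex \<times> complex \<Rightarrow> complex" where
  "bergman_projection \<Omega> u =
     (SOME h. h \<in> bergman_space \<Omega> \<and>
        (\<forall>k\<in>bergman_space \<Omega>. L2_inner \<Omega> (\<lambda>z. u z - h z) k = 0))"

definition hankel_dom ::
    "(complex \<times> complex) set \<Rightarrow> (complex \<times> complex \<Rightarrow> complex)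
      \<Rightarrow> (complex \<times> complex \<Rightarrow> complex) set" where
  "hankel_dom \<Omega> \<phi> = {g \<in> bergman_space \<Omega>. (\<lambda>z. \<phi> z * g z) \<in> L2 \<Omega>}"

definition hankel ::
    "(complex \<times> complex) set \<Rightarrow> (complex \<times> complex \<Rightarrow> complex)
      \<Rightarrow> (complex \<times> complex \<Rightarrow> complex) \<Rightarrow> complex \<times> complex \<Rightarrow> complex" where
  "hankel \<Omega> \<phi> g = (\<lambda>z. \<phi> z * g z - bergman_projection \<Omega> (\<lambda>w. \<phi> w * g w) z)"

text \<open>Compact linear operators from \<open>bergman_space \<Omega>\<close> to \<open>L2 \<Omega>\<close>. Compatibility with equality on
  \<open>\<Omega>\<close> is not listed, because it follows from linearity and the last clause: multiples of a
  difference of norm 0 form a bounded sequence.\<close>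

definition compact_operator ::
    "(complex \<times> complex) set
      \<Rightarrow> ((complex \<times> complex \<Rightarrow> complex) \<Rightarrow> complex \<times> complex \<Rightarrow> complex) \<Rightarrow> bool" where
  "compact_operator \<Omega> T \<longleftrightarrow>
     (\<forall>g\<in>bergman_space \<Omega>. T g \<in> L2 \<Omega>) \<and>
     (\<forall>g\<in>bergman_space \<Omega>. \<forall>h\<in>bergman_space \<Omega>.
        AE z in lebesgue_on \<Omega>. T (\<lambda>w. g w + h w) z = T g z + T h z) \<and>
     (\<forall>c. \<forall>g\<in>bergman_space \<Omega>. AE z in lebesgue_on \<Omega>. T (\<lambda>w. c * g w) z = c * T g z) \<and>
     (\<forall>g :: nat \<Rightarrow> complex \<times> complex \<Rightarrow> complex.
        range g \<subseteq> bergman_space \<Omega> \<and> bounded (range (\<lambda>n. L2_norm \<Omega> (g n))) \<longrightarrow>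
        (\<exists>r h. strict_mono r \<and> h \<in> L2 \<Omega> \<and>
           (\<lambda>n. L2_norm \<Omega> (\<lambda>z. T (g (r n)) z - h z)) \<longlonglongrightarrow> 0))"

text \<open>A Hankel operator is a priori defined only on \<open>hankel_dom \<Omega> \<phi>\<close>; compactness on all of
  \<open>bergman_space \<Omega>\<close> means that it extends to a compact operator there. The extension is unique
  (almost everywhere) as soon as \<open>hankel_dom \<Omega> \<phi>\<close> is dense. This is automatic if \<open>\<Omega>\<close> is a bounded
  convex Reinhardt domain and \<open>\<phi> \<in> L2 \<Omega>\<close>, since the domain then contains the polynomials.\<close>

definition compact_hankel ::
    "(complex \<times> complex) set \<Rightarrow> (complex \<times> complex \<Rightarrow> complex) \<Rightarrow> bool" where
  "compact_hankel \<Omega> \<phi> \<longleftrightarrow>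
     (\<exists>T. compact_operator \<Omega> T \<and>
        (\<forall>g\<in>hankel_dom \<Omega> \<phi>. AE z in lebesgue_on \<Omega>. T g z = hankel \<Omega> \<phi> g z))"

text \<open>The closure of the union of all non-trivial analytic discs in the boundary.\<close>

definition boundary_discs :: "(complex \<times> complex) set \<Rightarrow> (complex \<times> complex) set" where
  "boundary_discs \<Omega> =
     closure (\<Union> {\<phi> ` ball 0 1 | \<phi> :: complex \<Rightarrow> complex \<times> complex.
        (fst \<circ> \<phi>) holomorphic_on ball 0 1 \<and> (snd \<circ> \<phi>) holomorphic_on ball 0 1 \<and>
        \<phi> ` ball 0 1 \<subseteq> frontier \<Omega> \<and> \<not> \<phi> constant_on ball 0 1})"

text \<open>The splitting of \<open>boundary_discs \<Omega>\<close> into a horizontal part \<open>\<Gamma>1\<close> and a vertical part \<open>\<Gamma>2\<close>,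
  either of which may be empty. For a bounded convex Reinhardt domain such \<open>\<Gamma>1\<close> and \<open>\<Gamma>2\<close> exist
  and are uniquely determined.\<close>

definition disc_decomposition ::
    "(complex \<times> complex) set \<Rightarrow> (complex \<times> complex) set \<Rightarrow> (complex \<times> complex) set \<Rightarrow> bool" where
  "disc_decomposition \<Omega> \<Gamma>1 \<Gamma>2 \<longleftrightarrow>
     boundary_discs \<Omega> = \<Gamma>1 \<union> \<Gamma>2 \<and>
     (\<Gamma>1 = {} \<or> (\<exists>r1>0. \<exists>s1>0. \<Gamma>1 = cball 0 r1 \<times> sphere 0 s1)) \<and>
     (\<Gamma>2 = {} \<or> (\<exists>r2>0. \<exists>s2>0. \<Gamma>2 = sphere 0 s2 \<times> cball 0 r2))"

end

theory Submission
  imports Defs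
begin

text \<open>Write \<open>a\<^sub>j\<^sub>k\<close> for the Taylor coefficients of \<open>f\<close> at the origin. All of them except \<open>a\<^sub>0\<^sub>0\<close> are shown
  to vanish: those with \<open>j > 0\<close> by testing the Hankel operator on powers of \<open>z\<^sub>2\<close>, those with
  \<open>k > 0\<close> by testing it on powers of \<open>z\<^sub>1\<close>.

  Let \<open>j > 0\<close>, let \<open>g\<^sub>n\<close> be \<open>z\<^sub>2\<^sup>n\<close> divided by its norm, and let \<open>v\<^sub>n = cnj (z\<^sub>1\<^sup>j z\<^sub>2\<^sup>k) g\<^sub>n\<close>.
  A rotation of \<open>z\<^sub>1\<close> acts on \<open>v\<^sub>n\<close> with the negative weight \<open>-j\<close>, so \<open>v\<^sub>n\<close> is orthogonal to the
  Bergman space and the projection drops out of the pairing of \<open>H g\<^sub>m = cnj f g\<^sub>m - P (cnj f g\<^sub>m)\<close>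
  with \<open>v\<^sub>n\<close> (lemma \<open>hankel_test_pairing\<close>). What is left is a moment of \<open>f\<close>, which the rotations
  evaluate (\<open>integral_symbol_shifted_mon\<close>): it gives \<open>cnj a\<^sub>j\<^sub>k \<parallel>v\<^sub>n\<parallel>\<^sup>2\<close> if \<open>m = n\<close>, and 0 if
  \<open>n > m + j + k\<close>. If \<open>H\<close> is compact, some subsequence of \<open>H g\<^sub>n\<close> converges; pairing
  \<open>H g\<^sub>n - H g\<^sub>m\<close> with \<open>v\<^sub>n\<close> along it shows that \<open>a\<^sub>j\<^sub>k \<parallel>v\<^sub>n\<parallel>\<^sup>2\<close> tends to 0 there
  (\<open>compact_hankel_imp_taylor2_eq_0\<close>).

  It remains to see that the norms of the \<open>v\<^sub>n\<close> stay away from 0, and this is what the analytic discs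
  are for. If the boundary contains the discs of radius \<open>r\<close> in the first variable
  over the circle \<open>|z\<^sub>2| = s\<close>, then \<open>\<Omega>\<close> contains the polydisc of radii \<open>r\<close> and \<open>s\<close> and lies in the
  cylinder \<open>|z\<^sub>2| < s\<close> (\<open>disc_in_frontier_fst\<close>). As \<open>n\<close> grows, the mass of \<open>g\<^sub>n\<close> moves to
  \<open>|z\<^sub>2| = s\<close>, where the slices of \<open>\<Omega>\<close> do not shrink to a point, so the factor \<open>z\<^sub>1\<^sup>j z\<^sub>2\<^sup>k\<close> costs
  only a constant (\<open>monomial_norm_lower_bound\<close>). The discs in the second variable play the same part
  for the powers of \<open>z\<^sub>1\<close>.\<close>

section \<open>Rotation invariance of Lebesgue measure\<close>

lemma distr_lborel_shear:
  fixes a :: real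
  shows "distr (lborel \<Otimes>\<^sub>M lborel) (lborel \<Otimes>\<^sub>M lborel) (\<lambda>(x, y). (x + a * y, y)) =
         lborel \<Otimes>\<^sub>M (lborel :: real measure)"
    and "distr (lborel \<Otimes>\<^sub>M lborel) (lborel \<Otimes>\<^sub>M lborel) (\<lambda>(x, y). (x, y + a * x)) =
         lborel \<Otimes>\<^sub>M (lborel :: real measure)"
proof -
  have translate: "emeasure lborel ((\<lambda>x. c + x) -` A) = emeasure lborel A"
    if "A \<in> sets borel" for A :: "real set" and c
    using that emeasure_distr[of "(+) c" lborel borel A] lborel_distr_plus[of c] by simp
  show "distr (lborel \<Otimes>\<^sub>M lborel) (lborel \<Otimes>\<^sub>M lborel) (\<lambda>(x, y). (x + a * y, y)) =
         lborel \<Otimes>\<^sub>M (lborel :: real measure)" (is "distr ?M _ ?S = _")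
  proof (rule measure_eqI)
    fix A assume "A \<in> sets (distr ?M ?M ?S)"
    then have A: "A \<in> sets ?M" by simp
    have m: "?S \<in> measurable ?M ?M" by measurable
    have "emeasure (distr ?M ?M ?S) A = emeasure ?M (?S -` A)"
      using A m by (subst emeasure_distr) (auto simp: space_pair_measure)
    also have "\<dots> = (\<integral>\<^sup>+ y. emeasure lborel ((\<lambda>x. (x, y)) -` (?S -` A)) \<partial>lborel)"
      using measurable_sets[OF m A] by (intro lborel_pair.emeasure_pair_measure_alt2) (auto simp: space_pair_measure)
    also have "\<dots> = (\<integral>\<^sup>+ y. emeasure lborel ((\<lambda>x. (x, y)) -` A) \<partial>lborel)"
    proof (rule nn_integral_cong)
      fix y :: real
      have "(\<lambda>x. (x, y)) -` (?S -` A) = (\<lambda>x. a * y + x) -` ((\<lambda>x. (x, y)) -` A)"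
        by (auto simp: add.commute)
      then show "emeasure lborel ((\<lambda>x. (x, y)) -` (?S -` A)) = emeasure lborel ((\<lambda>x. (x, y)) -` A)"
        using translate[of "(\<lambda>x. (x, y)) -` A" "a * y"] sets_Pair2[OF A, of y] by simp
    qed
    also have "\<dots> = emeasure ?M A"
      using A by (intro lborel_pair.emeasure_pair_measure_alt2[symmetric])
    finally show "emeasure (distr ?M ?M ?S) A = emeasure ?M A" .
  qed simp
  show "distr (lborel \<Otimes>\<^sub>M lborel) (lborel \<Otimes>\<^sub>M lborel) (\<lambda>(x, y). (x, y + a * x)) =
         lborel \<Otimes>\<^sub>M (lborel :: real measure)" (is "distr ?M _ ?S = _")
  proof (rule measure_eqI)
    fix A assume "A \<in> sets (distr ?M ?M ?S)"
    then have A: "A \<in> sets ?M" by simp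
    have m: "?S \<in> measurable ?M ?M" by measurable
    have "emeasure (distr ?M ?M ?S) A = emeasure ?M (?S -` A)"
      using A m by (subst emeasure_distr) (auto simp: space_pair_measure)
    also have "\<dots> = (\<integral>\<^sup>+ x. emeasure lborel (Pair x -` (?S -` A)) \<partial>lborel)"
      using measurable_sets[OF m A] by (intro lborel.emeasure_pair_measure_alt) (auto simp: space_pair_measure)
    also have "\<dots> = (\<integral>\<^sup>+ x. emeasure lborel (Pair x -` A) \<partial>lborel)"
    proof (rule nn_integral_cong)
      fix x :: real
      have "Pair x -` (?S -` A) = (\<lambda>y. a * x + y) -` (Pair x -` A)"
        by (auto simp: add.commute)
      then show "emeasure lborel (Pair x -` (?S -` A)) = emeasure lborel (Pair x -` A)"
        using translate[of "Pair x -` A" "a * x"] sets_Pair1[OF A, of x] by simp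
    qed
    also have "\<dots> = emeasure ?M A"
      using A by (intro lborel.emeasure_pair_measure_alt[symmetric])
    finally show "emeasure (distr ?M ?M ?S) A = emeasure ?M A" .
  qed simp
qed

lemma measurable_Complex_pair:
  "(\<lambda>(x, y). Complex x y) \<in> measurable (lborel \<Otimes>\<^sub>M lborel) borel"
proof -
  have "continuous_on UNIV (\<lambda>p. Complex (fst p) (snd p))"
    by (intro continuous_intros)
  from borel_measurable_continuous_onI[OF this] show ?thesis
    by (simp add: lborel_prod case_prod_unfold)
qed

lemma distr_lborel_Complex:
  "distr (lborel \<Otimes>\<^sub>M lborel) borel (\<lambda>(x, y). Complex x y) = (lborel :: complex measure)"
proof (rule lborel_eqI[symmetric])
  note measurable_Complex_pair[measurable]
  fix l u :: complex assume le: "\<And>b. b \<in> Basis \<Longrightarrow> l \<bullet> b \<le> u \<bullet> b"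
  have eq: "(\<lambda>(x, y). Complex x y) -` box l u = box (Re l) (Re u) \<times> box (Im l) (Im u)"
    by (auto simp: box_def Basis_complex_def)
  have re: "Re l \<le> Re u" "Im l \<le> Im u"
    using le[of 1] le[of \<i>] by (auto simp: Basis_complex_def)
  have "emeasure (distr (lborel \<Otimes>\<^sub>M lborel) borel (\<lambda>(x, y). Complex x y)) (box l u)
     = emeasure (lborel \<Otimes>\<^sub>M lborel) (box (Re l) (Re u) \<times> box (Im l) (Im u))"
    by (subst emeasure_distr) (auto simp: space_pair_measure eq)
  also have "\<dots> = ennreal ((Re u - Re l) * (Im u - Im l))"
    using re by (subst lborel.emeasure_pair_measure_Times) (auto simp: ennreal_mult)
  also have "\<dots> = (\<Prod>b\<in>Basis. (u - l) \<bullet> b)"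
    by (simp add: Basis_complex_def prod.insert)
  finally show "emeasure (distr (lborel \<Otimes>\<^sub>M lborel) borel (\<lambda>(x, y). Complex x y)) (box l u)
      = ennreal (\<Prod>b\<in>Basis. (u - l) \<bullet> b)" .
qed simp

text \<open>A rotation by \<open>\<zeta> \<noteq> -1\<close> is a composition of three shears, each of which preserves planar
  measure because it translates every line of one direction. The rotation by \<open>-1\<close> is reached by
  rotating twice by a square root.\<close>

lemma distr_lborel_rotation:
  assumes "cmod \<zeta> = 1"
  shows "distr lborel borel (\<lambda>z. \<zeta> * z) = (lborel :: complex measure)"
proof -
  let ?M = "lborel \<Otimes>\<^sub>M (lborel :: real measure)"
  have main: "distr lborel borel (\<lambda>z. \<zeta> * z) = (lborel :: complex measure)"
    if "cmod \<zeta> = 1" "Re \<zeta> \<noteq> - 1" for \<zeta>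
  proof -
    \<comment> \<open>The slope \<open>t\<close> is the tangent of half the angle.\<close>
    define s where "s = Im \<zeta>"
    define t where "t = s / (1 + Re \<zeta>)"
    have sq: "(Re \<zeta>)\<^sup>2 + s\<^sup>2 = 1" using that by (simp add: s_def cmod_def)
    have nz: "1 + Re \<zeta> \<noteq> 0" using that by auto
    have t1: "t * (1 + Re \<zeta>) = s" using nz by (simp add: t_def)
    have ts: "t * s = 1 - Re \<zeta>"
      using nz sq by (simp add: t_def field_simps power2_eq_square)
    let ?A = "\<lambda>(x, y). (x + (- t) * y, y :: real)" and ?B = "\<lambda>(x, y). (x :: real, y + s * x)"
    let ?C = "\<lambda>(x, y). Complex x y"
    note C[measurable] = measurable_Complex_pair
    have A[measurable]: "?A \<in> measurable ?M ?M" and B[measurable]: "?B \<in> measurable ?M ?M"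
      by measurable
    have eq: "(\<lambda>z. \<zeta> * z) \<circ> ?C = ?C \<circ> (?A \<circ> (?B \<circ> ?A))"
    proof (rule ext, clarify)
      fix x y :: real
      have 1: "x * Re \<zeta> - y * s = x - t * y - t * (y + s * (x - t * y))"
      proof -
        have "x - t * y - t * (y + s * (x - t * y)) = x * (1 - t * s) - y * (t * (1 + (1 - t * s)))"
          by (simp add: algebra_simps)
        also have "\<dots> = x * Re \<zeta> - y * s" by (simp add: ts t1)
        finally show ?thesis by simp
      qed
      have 2: "x * s + y * Re \<zeta> = y + s * (x - t * y)"
      proof -
        have "y + s * (x - t * y) = x * s + y * (1 - t * s)" by (simp add: algebra_simps)
        then show ?thesis by (simp add: ts)
      qed
      show "((\<lambda>z. \<zeta> * z) \<circ> ?C) (x, y) = (?C \<circ> (?A \<circ> (?B \<circ> ?A))) (x, y)"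
        using 1 2 by (simp add: complex_eq_iff s_def algebra_simps)
    qed
    have "distr lborel borel (\<lambda>z. \<zeta> * z) = distr (distr ?M borel ?C) borel (\<lambda>z. \<zeta> * z)"
      by (simp add: distr_lborel_Complex)
    also have "\<dots> = distr ?M borel ((\<lambda>z. \<zeta> * z) \<circ> ?C)"
      by (rule distr_distr) measurable
    also have "\<dots> = distr (distr ?M ?M (?A \<circ> (?B \<circ> ?A))) borel ?C"
      unfolding eq by (rule distr_distr[symmetric, OF C measurable_comp[OF measurable_comp[OF A B] A]])
    also have "distr ?M ?M (?A \<circ> (?B \<circ> ?A)) = distr (distr ?M ?M (?B \<circ> ?A)) ?M ?A"
      by (rule distr_distr[symmetric, OF A measurable_comp[OF A B]])
    also have "distr ?M ?M (?B \<circ> ?A) = distr (distr ?M ?M ?A) ?M ?B"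
      by (rule distr_distr[symmetric, OF B A])
    also have "distr (distr (distr (distr ?M ?M ?A) ?M ?B) ?M ?A) borel ?C = lborel"
      by (simp only: distr_lborel_shear distr_lborel_Complex)
    finally show ?thesis .
  qed
  \<comment> \<open>The square root has nonnegative real part, so it is never \<open>-1\<close>.\<close>
  let ?r = "csqrt \<zeta>"
  have r: "?r * ?r = \<zeta>" by (metis power2_csqrt power2_eq_square)
  have "cmod ?r * cmod ?r = 1" using assms r by (metis norm_mult)
  then have "cmod ?r = 1" by (metis abs_norm_cancel abs_mult_self_eq real_sqrt_abs2 real_sqrt_one)
  moreover have "Re ?r \<noteq> - 1" using Re_csqrt[of \<zeta>] by linarith
  ultimately have R: "distr lborel borel (\<lambda>z. ?r * z) = (lborel :: complex measure)" by (rule main)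
  have "distr lborel borel (\<lambda>z. \<zeta> * z) = distr (distr lborel borel (\<lambda>z. ?r * z)) borel (\<lambda>z. ?r * z)"
    by (subst distr_distr) (auto simp: o_def mult.assoc[symmetric] r)
  also have "\<dots> = lborel" by (simp add: R)
  finally show ?thesis .
qed

lemma distr_lborel_rotation_fst:
  assumes "cmod \<zeta> = 1"
  shows "distr lborel borel (\<lambda>z. (\<zeta> * fst z, snd z)) = (lborel :: (complex \<times> complex) measure)"
proof -
  have "distr lborel borel (\<lambda>z. z) = (lborel :: complex measure)"
    using distr_id2[of borel lborel] by simp
  then have "distr lborel borel (\<lambda>z. \<zeta> * z) \<Otimes>\<^sub>M distr lborel borel (\<lambda>z. z) =
      (lborel :: (complex \<times> complex) measure)"
    using distr_lborel_rotation[OF assms] by (simp add: lborel_prod)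
  moreover have "distr lborel borel (\<lambda>z. \<zeta> * z) \<Otimes>\<^sub>M distr lborel borel (\<lambda>z. z) =
     distr (lborel \<Otimes>\<^sub>M lborel) (borel \<Otimes>\<^sub>M (borel :: complex measure)) (\<lambda>(x, y). (\<zeta> * x, y))"
    by (intro pair_measure_distr) (auto simp: \<open>distr lborel borel (\<lambda>z. z) = _\<close> lborel.sigma_finite_measure_axioms)
  ultimately show ?thesis by (simp add: lborel_prod borel_prod case_prod_unfold)
qed

lemma distr_lborel_rotation_snd:
  assumes "cmod \<zeta> = 1"
  shows "distr lborel borel (\<lambda>z. (fst z, \<zeta> * snd z)) = (lborel :: (complex \<times> complex) measure)"
proof -
  have "distr lborel borel (\<lambda>z. z) = (lborel :: complex measure)"
    using distr_id2[of borel lborel] by simp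
  then have "distr lborel borel (\<lambda>z. z) \<Otimes>\<^sub>M distr lborel borel (\<lambda>z. \<zeta> * z) =
      (lborel :: (complex \<times> complex) measure)"
    using distr_lborel_rotation[OF assms] by (simp add: lborel_prod)
  moreover have "distr lborel borel (\<lambda>z. z) \<Otimes>\<^sub>M distr lborel borel (\<lambda>z. \<zeta> * z) =
     distr (lborel \<Otimes>\<^sub>M lborel) (borel \<Otimes>\<^sub>M (borel :: complex measure)) (\<lambda>(x, y). (x, \<zeta> * y))"
    by (intro pair_measure_distr)
       (auto simp: distr_lborel_rotation[OF assms] lborel.sigma_finite_measure_axioms)
  ultimately show ?thesis unfolding lborel_prod borel_prod case_prod_unfold by (rule trans[OF sym, rotated])
qed

text \<open>An integral may be replaced by the integral of the averages over any measure-preserving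
  family of transformations. This reduces the orthogonality relations on a Reinhardt domain to
  integrals over circles.\<close>

lemma integral_flow_average:
  fixes F :: "'a::euclidean_space \<Rightarrow> complex" and \<rho> :: "real \<Rightarrow> 'a \<Rightarrow> 'a"
  assumes "open \<Omega>" "continuous_on \<Omega> F" and int: "set_integrable lborel \<Omega> F"
    and cont: "continuous_on UNIV (\<lambda>(t, z). \<rho> t z)"
    and inv: "\<And>t z. \<rho> t z \<in> \<Omega> \<longleftrightarrow> z \<in> \<Omega>"
    and mp: "\<And>t. distr lborel borel (\<rho> t) = lborel"
  shows "set_integrable lborel \<Omega> (\<lambda>z. integral {0..1} (\<lambda>t. F (\<rho> t z)))"
    and "(LINT z:\<Omega>|lborel. integral {0..1} (\<lambda>t. F (\<rho> t z))) = (LINT z:\<Omega>|lborel. F z)"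
proof -
  define F' where "F' = (\<lambda>z. indicator \<Omega> z *\<^sub>R F z)"
  have F'm[measurable]: "F' \<in> borel_measurable borel"
    using assms(1,2) unfolding F'_def by (intro borel_measurable_continuous_on_indicator) auto
  have F'i: "integrable lborel F'" using int by (simp add: F'_def set_integrable_def)
  have \<rho>m: "(\<lambda>p. \<rho> (fst p) (snd p)) \<in> borel_measurable (lborel \<Otimes>\<^sub>M lborel)"
    using borel_measurable_continuous_onI[OF cont] by (simp add: lborel_prod case_prod_unfold)
  have slices: "continuous_on UNIV (\<lambda>w :: 'a. (t, w))" "continuous_on UNIV (\<lambda>s :: real. (s, z))"
    for t :: real and z :: 'a
    by (intro continuous_intros)+
  have \<rho>c: "continuous_on UNIV (\<rho> t)" "continuous_on UNIV (\<lambda>t. \<rho> t z)" for t z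
    using continuous_on_compose2[OF cont, of UNIV "\<lambda>z. (t, z)"]
          continuous_on_compose2[OF cont, of UNIV "\<lambda>t. (t, z)"] slices
    by simp_all
  then have \<rho>m1[measurable]: "\<rho> t \<in> borel_measurable borel" for t
    by (intro borel_measurable_continuous_onI)
  define G where "G = (\<lambda>t z. indicator {0..1} t *\<^sub>R F' (\<rho> t z))"
  have Gm: "case_prod G \<in> borel_measurable (lborel \<Otimes>\<^sub>M lborel)"
    unfolding G_def case_prod_unfold
    using measurable_compose[OF \<rho>m F'm] by measurable
  have Fi: "integrable lborel (\<lambda>z. F' (\<rho> t z))" for t
    using integrable_distr[of "\<rho> t" lborel borel F'] F'i mp[of t] by simp
  have Fe: "(LINT z|lborel. F' (\<rho> t z)) = (LINT z|lborel. F' z)" for t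
    using integral_distr[of "\<rho> t" lborel borel F'] mp[of t] by simp
  have Fn: "(LINT z|lborel. norm (F' (\<rho> t z))) = (LINT z|lborel. norm (F' z))" for t
    using integral_distr[of "\<rho> t" lborel borel "\<lambda>z. norm (F' z)"] mp[of t] by simp
  have Gi: "integrable (lborel \<Otimes>\<^sub>M lborel) (case_prod G)"
  proof (rule lborel_pair.Fubini_integrable[OF Gm])
    show "integrable lborel (\<lambda>x. LINT y|lborel. norm (case (x, y) of (x, xa) \<Rightarrow> G x xa))"
      by (simp add: G_def Fn)
    show "AE x in lborel. integrable lborel (\<lambda>y. case (x, y) of (x, xa) \<Rightarrow> G x xa)"
      by (simp add: G_def Fi)
  qed
  have inner: "(LINT t|lborel. G t z) = indicator \<Omega> z *\<^sub>R integral {0..1} (\<lambda>t. F (\<rho> t z))" for z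
  proof (cases "z \<in> \<Omega>")
    case True
    have "continuous_on {0..1} (\<lambda>t. F (\<rho> t z))"
      using continuous_on_subset[OF \<rho>c(2)] True inv
      by (intro continuous_on_compose2[OF assms(2)]) auto
    then have "set_integrable lborel {0..1} (\<lambda>t. F (\<rho> t z))"
      by (rule borel_integrable_atLeastAtMost')
    from set_borel_integral_eq_integral(2)[OF this] True show ?thesis
      by (simp add: G_def F'_def set_lebesgue_integral_def inv)
  next
    case False
    then show ?thesis by (simp add: G_def F'_def inv)
  qed
  show "set_integrable lborel \<Omega> (\<lambda>z. integral {0..1} (\<lambda>t. F (\<rho> t z)))"
    using lborel_pair.integrable_snd[OF Gi] by (simp add: inner set_integrable_def)
  have "(LINT z:\<Omega>|lborel. integral {0..1} (\<lambda>t. F (\<rho> t z))) = (LINT z|lborel. LINT t|lborel. G t z)"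
    by (simp add: inner set_lebesgue_integral_def)
  also have "\<dots> = (LINT t|lborel. LINT z|lborel. G t z)"
    by (rule lborel_pair.Fubini_integral[OF Gi])
  also have "\<dots> = (LINT t|lborel. indicator {0..1 :: real} t *\<^sub>R (LINT z|lborel. F' z))"
    by (intro Bochner_Integration.integral_cong refl) (simp add: G_def Fe)
  also have "\<dots> = (LINT z|lborel. F' z)"
    by (subst integral_scaleR_left) auto
  finally show "(LINT z:\<Omega>|lborel. integral {0..1} (\<lambda>t. F (\<rho> t z))) = (LINT z:\<Omega>|lborel. F z)"
    by (simp add: F'_def set_lebesgue_integral_def)
qed

section \<open>Circle means of holomorphic functions\<close>

lemma circle_integral_eq:
  assumes "(f has_contour_integral I) (circlepath c r)"
  shows "integral {0..1} (\<lambda>t. f (c + of_real r * cis (2 * pi * t)) * (of_real r * cis (2 * pi * t))) = I / (2 * pi * \<i>)"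
proof -
  have two_pi_i: "2 * pi * \<i> \<noteq> 0" by simp
  have "((\<lambda>t. f (circlepath c r t) * vector_derivative (circlepath c r) (at t within {0..1})) has_integral I) {0..1}"
    using assms by (simp add: has_contour_integral_def)
  then have "((\<lambda>t. f (c + of_real r * cis (2 * pi * t)) * (of_real r * cis (2 * pi * t)) * (2 * pi * \<i>)) has_integral I) {0..1}"
  proof (rule has_integral_eq[rotated])
    fix t :: real assume t: "t \<in> {0..1}"
    have "cis (2 * pi * t) = exp (2 * of_real pi * \<i> * of_real t)"
      by (simp add: cis_conv_exp mult_ac)
    then show "f (circlepath c r t) * vector_derivative (circlepath c r) (at t within {0..1}) =
        f (c + of_real r * cis (2 * pi * t)) * (of_real r * cis (2 * pi * t)) * (2 * pi * \<i>)"
      using t vector_derivative_circlepath01[of t c r] by (simp only: circlepath) simp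
  qed
  from has_integral_divide[OF this, of "2 * pi * \<i>"] show ?thesis
    by (intro integral_unique) (simp only: nonzero_mult_div_cancel_right[OF two_pi_i])
qed

text \<open>Cauchy's formula for the function \<open>w \<mapsto> h (z w)\<close> on the unit circle. Rescaling to the unit
  circle covers \<open>z = 0\<close> as well.\<close>

lemma circle_mean_eq_taylor_coeff:
  assumes "open U" "h holomorphic_on U" "cball 0 (cmod z) \<subseteq> U"
  shows "integral {0..1} (\<lambda>t. h (cis (2 * pi * t) * z) * cnj (cis (2 * pi * t)) ^ n) =
         (deriv ^^ n) h 0 / fact n * z ^ n"
proof -
  define V where "V = (\<lambda>w. z * w) -` U"
  have V: "open V" unfolding V_def
    by (intro open_vimage assms continuous_intros)
  have cb: "cball 0 1 \<subseteq> V"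
  proof
    fix w :: complex assume "w \<in> cball 0 1"
    then have "z * w \<in> cball 0 (cmod z)" by (simp add: norm_mult mult_left_le)
    then show "w \<in> V" using assms(3) by (auto simp: V_def)
  qed
  have hol: "(\<lambda>w. h (z * w)) holomorphic_on V"
    using assms(2) by (intro holomorphic_on_compose_gen[of "\<lambda>w. z * w" V h U, unfolded o_def])
      (auto simp: V_def intro!: holomorphic_intros)
  have "((\<lambda>u. h (z * u) / (u - 0) ^ Suc n) has_contour_integral
      2 * pi * \<i> / fact n * (deriv ^^ n) (\<lambda>w. h (z * w)) 0) (circlepath 0 1)"
  proof (rule Cauchy_has_contour_integral_higher_derivative_circlepath)
    show "continuous_on (cball 0 1) (\<lambda>w. h (z * w))"
      using holomorphic_on_imp_continuous_on[OF hol] cb by (rule continuous_on_subset)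
    show "(\<lambda>w. h (z * w)) holomorphic_on ball 0 1"
      using hol cb by (rule holomorphic_on_subset[OF _ subset_trans[OF ball_subset_cball]])
  qed simp
  from circle_integral_eq[OF this]
  have "integral {0..1} (\<lambda>t. h (z * cis (2 * pi * t)) / cis (2 * pi * t) ^ n) =
      (deriv ^^ n) (\<lambda>w. h (z * w)) 0 / fact n"
    by (simp add: field_simps)
  also have "(deriv ^^ n) (\<lambda>w. h (z * w)) 0 = z ^ n * (deriv ^^ n) h (z * 0)"
    by (rule higher_deriv_compose_linear[OF assms(2) V assms(1)]) (use subsetD[OF cb, of 0] in \<open>auto simp: V_def\<close>)
  also have "(\<lambda>t. h (z * cis (2 * pi * t)) / cis (2 * pi * t) ^ n) =
     (\<lambda>t. h (cis (2 * pi * t) * z) * cnj (cis (2 * pi * t)) ^ n)"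
  proof
    fix t
    have "cnj (cis (2 * pi * t)) = inverse (cis (2 * pi * t))"
      by (simp only: cis_cnj cis_inverse)
    then show "h (z * cis (2 * pi * t)) / cis (2 * pi * t) ^ n =
        h (cis (2 * pi * t) * z) * cnj (cis (2 * pi * t)) ^ n"
      by (simp only: divide_inverse power_inverse mult.commute[of z])
  qed
  finally show ?thesis by simp
qed

text \<open>Positive powers of the angle only meet the missing negative Fourier modes of \<open>h\<close>: the
  integral is the value at 0 of a holomorphic function that vanishes there.\<close>

lemma circle_mean_eq_0:
  assumes "open U" "h holomorphic_on U" "cball 0 (cmod z) \<subseteq> U" "l > 0"
  shows "integral {0..1} (\<lambda>t. h (cis (2 * pi * t) * z) * cis (2 * pi * t) ^ l) = 0"
proof -
  define V where "V = (\<lambda>w. w * z) -` U"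
  have V: "open V" unfolding V_def
    by (intro open_vimage assms continuous_intros)
  have cb: "cball 0 (cmod 1) \<subseteq> V"
  proof
    fix w :: complex assume "w \<in> cball 0 (cmod 1)"
    then have "w * z \<in> cball 0 (cmod z)" by (simp add: norm_mult mult_left_le_one_le)
    then show "w \<in> V" using assms(3) by (auto simp: V_def)
  qed
  have "(\<lambda>w. h (w * z)) holomorphic_on V"
    using assms(2) by (intro holomorphic_on_compose_gen[of "\<lambda>w. w * z" V h U, unfolded o_def])
      (auto simp: V_def intro!: holomorphic_intros)
  then have "(\<lambda>w. h (w * z) * w ^ l) holomorphic_on V"
    by (intro holomorphic_intros)
  from circle_mean_eq_taylor_coeff[OF V this cb, of 0] \<open>l > 0\<close> show ?thesis by simp
qed

lemma deriv_eq_circle_integral: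
  assumes "open U" "h holomorphic_on U" "cball c r \<subseteq> U" "w \<in> ball c r"
  shows "deriv h w = integral {0..1} (\<lambda>t. h (c + of_real r * cis (2 * pi * t)) /
      (c + of_real r * cis (2 * pi * t) - w)\<^sup>2 * (of_real r * cis (2 * pi * t)))"
proof -
  have "((\<lambda>u. h u / (u - w) ^ Suc 1) has_contour_integral
      2 * pi * \<i> / fact 1 * (deriv ^^ 1) h w) (circlepath c r)"
    using assms(4)
  proof (rule Cauchy_has_contour_integral_higher_derivative_circlepath[rotated 2])
    show "continuous_on (cball c r) h"
      using holomorphic_on_imp_continuous_on[OF assms(2)] assms(3) by (rule continuous_on_subset)
    show "h holomorphic_on ball c r"
      using assms(2,3) by (rule holomorphic_on_subset[OF _ subset_trans[OF ball_subset_cball]])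
  qed
  from circle_integral_eq[OF this] show ?thesis by (simp add: power2_eq_square)
qed

section \<open>Holomorphic functions of two variables\<close>

lemma holomorphic2_on_imp_continuous_on: "holomorphic2_on F \<Omega> \<Longrightarrow> continuous_on \<Omega> F"
  unfolding holomorphic2_on_def
  by (meson continuous_at_imp_continuous_on has_derivative_continuous)

lemma holomorphic2_on_imp_holomorphic_fst:
  assumes "holomorphic2_on F \<Omega>"
  shows "(\<lambda>z. F (z, w)) holomorphic_on {z. (z, w) \<in> \<Omega>}"
  unfolding holomorphic_on_def
proof safe
  fix z assume "(z, w) \<in> \<Omega>"
  then obtain a b where ab: "(F has_derivative (\<lambda>(h1, h2). a * h1 + b * h2)) (at (z, w))"
    using assms unfolding holomorphic2_on_def by blast
  have "((\<lambda>z. (z, w)) has_derivative (\<lambda>h. (h, 0))) (at z)"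
    by (intro derivative_intros)
  from has_derivative_compose[OF this ab]
  have "((\<lambda>z. F (z, w)) has_field_derivative a) (at z)"
    by (simp add: has_field_derivative_def)
  then show "(\<lambda>z. F (z, w)) field_differentiable at z within {z. (z, w) \<in> \<Omega>}"
    using field_differentiable_at_within field_differentiable_def by blast
qed

lemma holomorphic2_on_imp_holomorphic_snd:
  assumes "holomorphic2_on F \<Omega>"
  shows "(\<lambda>w. F (z, w)) holomorphic_on {w. (z, w) \<in> \<Omega>}"
  unfolding holomorphic_on_def
proof safe
  fix w assume "(z, w) \<in> \<Omega>"
  then obtain a b where ab: "(F has_derivative (\<lambda>(h1, h2). a * h1 + b * h2)) (at (z, w))"
    using assms unfolding holomorphic2_on_def by blast
  have "((\<lambda>w. (z, w)) has_derivative (\<lambda>h. (0, h))) (at w)"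
    by (intro derivative_intros)
  from has_derivative_compose[OF this ab]
  have "((\<lambda>w. F (z, w)) has_field_derivative b) (at w)"
    by (simp add: has_field_derivative_def)
  then show "(\<lambda>w. F (z, w)) field_differentiable at w within {w. (z, w) \<in> \<Omega>}"
    using field_differentiable_at_within field_differentiable_def by blast
qed

lemma holomorphic2_on_const: "holomorphic2_on (\<lambda>z. c) \<Omega>"
  unfolding holomorphic2_on_def
proof
  fix z :: "complex \<times> complex"
  show "\<exists>a b. ((\<lambda>z. c) has_derivative (\<lambda>(h1, h2). a * h1 + b * h2)) (at z)"
    by (intro exI[of _ 0]) (simp add: case_prod_unfold)
qed

lemma holomorphic2_on_fst: "holomorphic2_on fst \<Omega>"
  unfolding holomorphic2_on_def
proof
  fix z :: "complex \<times> complex"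
  have "(fst has_derivative (\<lambda>(h1, h2). 1 * h1 + 0 * h2)) (at z)"
    by (auto simp: case_prod_unfold intro!: derivative_eq_intros)
  then show "\<exists>a b. (fst has_derivative (\<lambda>(h1, h2). a * h1 + b * h2)) (at z)" by blast
qed

lemma holomorphic2_on_snd: "holomorphic2_on snd \<Omega>"
  unfolding holomorphic2_on_def
proof
  fix z :: "complex \<times> complex"
  have "(snd has_derivative (\<lambda>(h1, h2). 0 * h1 + 1 * h2)) (at z)"
    by (auto simp: case_prod_unfold intro!: derivative_eq_intros)
  then show "\<exists>a b. (snd has_derivative (\<lambda>(h1, h2). a * h1 + b * h2)) (at z)" by blast
qed

lemma holomorphic2_on_add:
  assumes "holomorphic2_on F \<Omega>" "holomorphic2_on G \<Omega>"
  shows "holomorphic2_on (\<lambda>z. F z + G z) \<Omega>"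
  unfolding holomorphic2_on_def
proof
  fix z assume "z \<in> \<Omega>"
  with assms obtain a b c d where "(F has_derivative (\<lambda>(h1, h2). a * h1 + b * h2)) (at z)"
    "(G has_derivative (\<lambda>(h1, h2). c * h1 + d * h2)) (at z)"
    unfolding holomorphic2_on_def by blast
  then have "((\<lambda>z. F z + G z) has_derivative (\<lambda>(h1, h2). (a + c) * h1 + (b + d) * h2)) (at z)"
    by (auto simp: case_prod_unfold algebra_simps intro!: derivative_eq_intros)
  then show "\<exists>a b. ((\<lambda>z. F z + G z) has_derivative (\<lambda>(h1, h2). a * h1 + b * h2)) (at z)" by blast
qed

lemma holomorphic2_on_mult:
  assumes "holomorphic2_on F \<Omega>" "holomorphic2_on G \<Omega>"
  shows "holomorphic2_on (\<lambda>z. F z * G z) \<Omega>"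
  unfolding holomorphic2_on_def
proof
  fix z assume "z \<in> \<Omega>"
  with assms obtain a b c d where "(F has_derivative (\<lambda>(h1, h2). a * h1 + b * h2)) (at z)"
    "(G has_derivative (\<lambda>(h1, h2). c * h1 + d * h2)) (at z)"
    unfolding holomorphic2_on_def by blast
  then have "((\<lambda>z. F z * G z) has_derivative
      (\<lambda>(h1, h2). (F z * c + a * G z) * h1 + (F z * d + b * G z) * h2)) (at z)"
    by (auto simp: case_prod_unfold algebra_simps intro!: derivative_eq_intros)
  then show "\<exists>a b. ((\<lambda>z. F z * G z) has_derivative (\<lambda>(h1, h2). a * h1 + b * h2)) (at z)" by blast
qed

lemma holomorphic2_on_power: "holomorphic2_on F \<Omega> \<Longrightarrow> holomorphic2_on (\<lambda>z. F z ^ n) \<Omega>"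
  by (induction n) (auto intro: holomorphic2_on_const holomorphic2_on_mult)

lemma holomorphic2_on_sum:
  "(\<And>i. i \<in> I \<Longrightarrow> holomorphic2_on (F i) \<Omega>) \<Longrightarrow> holomorphic2_on (\<lambda>z. \<Sum>i\<in>I. F i z) \<Omega>"
  by (induction I rule: infinite_finite_induct) (auto intro: holomorphic2_on_const holomorphic2_on_add)

lemmas holomorphic2_intros = holomorphic2_on_const holomorphic2_on_fst holomorphic2_on_snd
  holomorphic2_on_add holomorphic2_on_mult holomorphic2_on_power holomorphic2_on_sum

definition taylor_fst :: "nat \<Rightarrow> (complex \<times> complex \<Rightarrow> complex) \<Rightarrow> complex \<Rightarrow> complex" where
  "taylor_fst j F w = (deriv ^^ j) (\<lambda>z. F (z, w)) 0 / fact j"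

text \<open>The coefficient of \<open>z\<^sub>1\<^sup>j z\<^sub>2\<^sup>k\<close> in the Taylor expansion of \<open>F\<close> at the origin, obtained by
  expanding in the two variables one after the other.\<close>

definition taylor2 :: "nat \<Rightarrow> nat \<Rightarrow> (complex \<times> complex \<Rightarrow> complex) \<Rightarrow> complex" where
  "taylor2 j k F = (deriv ^^ k) (taylor_fst j F) 0 / fact k"

section \<open>Moments on complete Reinhardt domains\<close>

definition radial :: "(complex \<times> complex \<Rightarrow> complex) \<Rightarrow> bool" where
  "radial \<omega> \<longleftrightarrow> continuous_on UNIV \<omega> \<and>
     (\<forall>\<zeta> z. cmod \<zeta> = 1 \<longrightarrow> \<omega> (\<zeta> * fst z, snd z) = \<omega> z \<and> \<omega> (fst z, \<zeta> * snd z) = \<omega> z)"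

locale complete_reinhardt =
  fixes \<Omega> :: "(complex \<times> complex) set"
  assumes open_dom: "open \<Omega>"
    and ne: "\<Omega> \<noteq> {}"
    and complete: "\<And>z1 z2 w1 w2. (z1, z2) \<in> \<Omega> \<Longrightarrow> cmod w1 \<le> cmod z1 \<Longrightarrow> cmod w2 \<le> cmod z2 \<Longrightarrow> (w1, w2) \<in> \<Omega>"
begin

lemma open_slice_fst: "open {z. (z, w) \<in> \<Omega>}"
  using open_vimage[OF open_dom, of "\<lambda>z. (z, w)"] by (simp add: vimage_def continuous_intros)

lemma open_slice_snd: "open {w. (z, w) \<in> \<Omega>}"
  using open_vimage[OF open_dom, of "\<lambda>w. (z, w)"] by (simp add: vimage_def continuous_intros)

lemma zero_mem: "(0, 0) \<in> \<Omega>"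
  using ne complete by fastforce

text \<open>Near a point \<open>w\<^sub>0\<close> the coefficient is an integral over one fixed small circle in the first
  variable, and one differentiates under the integral sign. The derivative in the second variable
  is jointly continuous because Cauchy's formula represents it by values of \<open>F\<close>.\<close>

lemma taylor_fst_holomorphic:
  assumes F: "holomorphic2_on F \<Omega>"
  shows "taylor_fst j F holomorphic_on {w. (0, w) \<in> \<Omega>}"
  unfolding holomorphic_on_def
proof safe
  fix w0 assume "(0, w0) \<in> \<Omega>"
  then obtain A B where AB: "open A" "open B" "0 \<in> A" "w0 \<in> B" "A \<times> B \<subseteq> \<Omega>"
    using open_dom open_prod_elim by (metis SigmaE2)
  obtain \<epsilon>1 where \<epsilon>1: "\<epsilon>1 > 0" "cball 0 \<epsilon>1 \<subseteq> A" using AB open_contains_cball by blast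
  obtain \<epsilon>2 where \<epsilon>2: "\<epsilon>2 > 0" "cball w0 \<epsilon>2 \<subseteq> B" using AB open_contains_cball by blast
  define e where "e = min \<epsilon>1 \<epsilon>2"
  have e: "e > 0" "cball 0 e \<times> cball w0 e \<subseteq> \<Omega>"
    using \<epsilon>1 \<epsilon>2 AB unfolding e_def by (auto simp: subset_iff)
  let ?c = "\<lambda>t. cis (2 * pi * t)"
  let ?f = "\<lambda>w t. F (?c t * of_real e, w) * cnj (?c t) ^ j"
  let ?fx = "\<lambda>w t. deriv (\<lambda>w. F (?c t * of_real e, w)) w * cnj (?c t) ^ j"
  have eq: "taylor_fst j F w = integral (cbox 0 1) (?f w) / of_real e ^ j" if "w \<in> ball w0 e" for w
  proof -
    have "cball 0 (cmod (of_real e)) \<subseteq> {z. (z, w) \<in> \<Omega>}"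
      using e that by (auto simp: subset_iff)
    from circle_mean_eq_taylor_coeff[OF open_slice_fst holomorphic2_on_imp_holomorphic_fst[OF F] this, of j]
    show ?thesis using e by (simp add: taylor_fst_def)
  qed
  have Fc: "continuous_on \<Omega> F" by (rule holomorphic2_on_imp_continuous_on[OF F])
  have mem: "(?c t * of_real e, w) \<in> \<Omega>" if "w \<in> cball w0 e" for w t
    using e that by (intro subsetD[OF e(2)]) (simp add: norm_mult)
  have mem_c: "w0 + of_real e * ?c s \<in> cball w0 e" for s
    using e by (simp add: dist_norm norm_mult)
  have "(\<lambda>w. integral (cbox 0 1) (?f w)) holomorphic_on ball w0 e"
  proof (rule leibniz_rule_holomorphic[where fx = ?fx])
    fix w t assume w: "w \<in> ball w0 e" and t: "t \<in> cbox 0 (1::real)"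
    have "(\<lambda>w. F (?c t * of_real e, w)) holomorphic_on {w. (?c t * of_real e, w) \<in> \<Omega>}"
      by (rule holomorphic2_on_imp_holomorphic_snd[OF F])
    moreover have "w \<in> {w. (?c t * of_real e, w) \<in> \<Omega>}"
      using mem w by simp
    ultimately have "((\<lambda>w. F (?c t * of_real e, w)) has_field_derivative deriv (\<lambda>w. F (?c t * of_real e, w)) w) (at w)"
      using open_slice_snd holomorphic_derivI by blast
    then show "((\<lambda>w. ?f w t) has_field_derivative ?fx w t) (at w within ball w0 e)"
      by (rule DERIV_cmult_right[OF has_field_derivative_at_within])
  next
    fix w assume w: "w \<in> ball w0 e"
    have "continuous_on (cbox 0 1) (?f w)"
    proof (intro continuous_intros continuous_on_compose2[OF Fc] image_subsetI)
      show "(?c t * of_real e, w) \<in> \<Omega>" for t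
        using w by (intro mem) simp
    qed
    then show "?f w integrable_on cbox 0 1" by (rule integrable_continuous)
  next
    let ?D = "\<lambda>(w, t). integral (cbox 0 1) (\<lambda>s. F (?c t * of_real e, w0 + of_real e * ?c s) /
         (w0 + of_real e * ?c s - w)\<^sup>2 * (of_real e * ?c s))"
    have "continuous_on (ball w0 e \<times> cbox 0 (1::real)) (\<lambda>p. integral (cbox 0 1) (\<lambda>s. F (?c (snd p) * of_real e, w0 + of_real e * ?c s) /
         (w0 + of_real e * ?c s - fst p)\<^sup>2 * (of_real e * ?c s)))"
    proof (rule integral_continuous_on_param)
      have nz: "w0 + of_real e * ?c s - w \<noteq> 0" if "w \<in> ball w0 e" for s w
      proof
        assume "w0 + of_real e * ?c s - w = 0"
        then have "w - w0 = of_real e * ?c s" by (simp add: algebra_simps)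
        then have "dist w w0 = e" using e by (simp add: dist_norm norm_mult)
        then show False using that by (simp add: dist_commute)
      qed
      show "continuous_on ((ball w0 e \<times> cbox 0 (1::real)) \<times> cbox 0 (1::real))
         (\<lambda>(p, s). F (?c (snd p) * of_real e, w0 + of_real e * ?c s) /
         (w0 + of_real e * ?c s - fst p)\<^sup>2 * (of_real e * ?c s))"
        unfolding case_prod_unfold
      proof (intro continuous_intros continuous_on_compose2[OF Fc] image_subsetI ballI)
        fix x :: "(complex \<times> real) \<times> real"
        assume "x \<in> (ball w0 e \<times> cbox 0 1) \<times> cbox 0 1"
        then have "fst (fst x) \<in> ball w0 e" by auto
        from nz[OF this] show "(w0 + of_real e * ?c (snd x) - fst (fst x))\<^sup>2 \<noteq> 0" by simp
      qed (intro mem mem_c)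
    qed
    then have "continuous_on (ball w0 e \<times> cbox 0 (1::real)) ?D" by (simp add: case_prod_unfold)
    then have "continuous_on (ball w0 e \<times> cbox 0 (1::real)) (\<lambda>p. ?D p * cnj (?c (snd p)) ^ j)"
      by (intro continuous_intros)
    moreover have "(case p of (w, t) \<Rightarrow> ?fx w t) = ?D p * cnj (?c (snd p)) ^ j"
      if "p \<in> ball w0 e \<times> cbox 0 (1::real)" for p
    proof -
      obtain w t where p: "p = (w, t)" by (cases p)
      then have w: "w \<in> ball w0 e" using that by simp
      have "cball w0 e \<subseteq> {w. (?c t * of_real e, w) \<in> \<Omega>}"
        using mem by blast
      from deriv_eq_circle_integral[OF open_slice_snd holomorphic2_on_imp_holomorphic_snd[OF F] this w]
      show ?thesis by (simp add: p)
    qed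
    ultimately show "continuous_on (ball w0 e \<times> cbox 0 1) (\<lambda>(w, t). ?fx w t)"
      by (subst continuous_on_cong[OF refl]) auto
  qed simp
  then have "(\<lambda>w. integral (cbox 0 1) (?f w) / of_real e ^ j) holomorphic_on ball w0 e"
    using e by (intro holomorphic_intros) auto
  then have "taylor_fst j F holomorphic_on ball w0 e"
    by (rule holomorphic_transform) (use eq in auto)
  then have "taylor_fst j F field_differentiable at w0"
    using e by (intro holomorphic_on_imp_differentiable_at[of _ "ball w0 e"]) auto
  then show "taylor_fst j F field_differentiable at w0 within {w. (0, w) \<in> \<Omega>}"
    by (rule field_differentiable_at_within)
qed

lemma rotate_mem:
  assumes "cmod \<zeta> = 1"
  shows "(\<zeta> * z1, z2) \<in> \<Omega> \<longleftrightarrow> (z1, z2) \<in> \<Omega>" "(z1, \<zeta> * z2) \<in> \<Omega> \<longleftrightarrow> (z1, z2) \<in> \<Omega>"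
  by (rule iffI; erule complete; simp add: norm_mult assms)+

lemma average_rotation_fst:
  fixes G :: "complex \<times> complex \<Rightarrow> complex"
  assumes "continuous_on \<Omega> G" "set_integrable lborel \<Omega> G"
  shows "set_integrable lborel \<Omega> (\<lambda>z. integral {0..1} (\<lambda>t. G (cis (2 * pi * t) * fst z, snd z)))"
    and "(LINT z:\<Omega>|lborel. integral {0..1} (\<lambda>t. G (cis (2 * pi * t) * fst z, snd z))) =
         (LINT z:\<Omega>|lborel. G z)"
proof -
  let ?\<rho> = "\<lambda>t z. (cis (2 * pi * t) * fst z, snd z) :: complex \<times> complex"
  have 1: "continuous_on UNIV (\<lambda>(t, z). ?\<rho> t z)"
    unfolding case_prod_unfold by (intro continuous_intros)
  have 2: "?\<rho> t z \<in> \<Omega> \<longleftrightarrow> z \<in> \<Omega>" for t z by (cases z) (simp add: rotate_mem)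
  have 3: "distr lborel borel (?\<rho> t) = lborel" for t by (rule distr_lborel_rotation_fst) simp
  note integral_flow_average[OF open_dom assms, of ?\<rho>, OF 1 2 3]
  then show "set_integrable lborel \<Omega> (\<lambda>z. integral {0..1} (\<lambda>t. G (?\<rho> t z)))"
   "(LINT z:\<Omega>|lborel. integral {0..1} (\<lambda>t. G (?\<rho> t z))) = (LINT z:\<Omega>|lborel. G z)" by blast+
qed

lemma average_rotation_snd:
  fixes G :: "complex \<times> complex \<Rightarrow> complex"
  assumes "continuous_on \<Omega> G" "set_integrable lborel \<Omega> G"
  shows "set_integrable lborel \<Omega> (\<lambda>z. integral {0..1} (\<lambda>t. G (fst z, cis (2 * pi * t) * snd z)))"
    and "(LINT z:\<Omega>|lborel. integral {0..1} (\<lambda>t. G (fst z, cis (2 * pi * t) * snd z))) =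
         (LINT z:\<Omega>|lborel. G z)"
proof -
  let ?\<rho> = "\<lambda>t z. (fst z, cis (2 * pi * t) * snd z) :: complex \<times> complex"
  have 1: "continuous_on UNIV (\<lambda>(t, z). ?\<rho> t z)"
    unfolding case_prod_unfold by (intro continuous_intros)
  have 2: "?\<rho> t z \<in> \<Omega> \<longleftrightarrow> z \<in> \<Omega>" for t z by (cases z) (simp add: rotate_mem)
  have 3: "distr lborel borel (?\<rho> t) = lborel" for t by (rule distr_lborel_rotation_snd) simp
  note integral_flow_average[OF open_dom assms, of ?\<rho>, OF 1 2 3]
  then show "set_integrable lborel \<Omega> (\<lambda>z. integral {0..1} (\<lambda>t. G (?\<rho> t z)))"
   "(LINT z:\<Omega>|lborel. integral {0..1} (\<lambda>t. G (?\<rho> t z))) = (LINT z:\<Omega>|lborel. G z)" by blast+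
qed

lemma slice_fst_cball: "z \<in> \<Omega> \<Longrightarrow> cball 0 (cmod (fst z)) \<subseteq> {w. (w, snd z) \<in> \<Omega>}"
  using complete[of "fst z" "snd z" _ "snd z"] by auto

lemma slice_snd_cball: "z \<in> \<Omega> \<Longrightarrow> cball 0 (cmod (snd z)) \<subseteq> {w. (fst z, w) \<in> \<Omega>}"
  using complete[of "fst z" "snd z" "fst z"] by auto

lemma slice_snd_cball_0: "z \<in> \<Omega> \<Longrightarrow> cball 0 (cmod (snd z)) \<subseteq> {w. (0, w) \<in> \<Omega>}"
  using complete[of "fst z" "snd z" 0] by auto

text \<open>Averaging over rotations of the first variable replaces \<open>F\<close> by the \<open>j\<close>-th term of its
  expansion in that variable; averaging over the second variable then leaves the single monomial
  with exponents \<open>j\<close> and \<open>k\<close>. The radial weight is untouched by both averages.\<close>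

lemma moment_eq_taylor2:
  assumes F: "holomorphic2_on F \<Omega>" and \<omega>: "radial \<omega>"
    and int: "set_integrable lborel \<Omega> (\<lambda>z. F z * cnj (fst z ^ j * snd z ^ k) * \<omega> z)"
  shows "(LINT z:\<Omega>|lborel. F z * cnj (fst z ^ j * snd z ^ k) * \<omega> z) =
     taylor2 j k F * (LINT z:\<Omega>|lborel. fst z ^ j * snd z ^ k * cnj (fst z ^ j * snd z ^ k) * \<omega> z)"
proof -
  let ?c = "\<lambda>t. cis (2 * pi * t)"
  note Fc = holomorphic2_on_imp_continuous_on[OF F]
  have \<omega>c: "continuous_on \<Omega> \<omega>" using \<omega> continuous_on_subset unfolding radial_def by blast
  have \<omega>r: "\<omega> (?c t * fst z, snd z) = \<omega> z" "\<omega> (fst z, ?c t * snd z) = \<omega> z" for t z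
    using \<omega> by (simp_all add: radial_def)
  let ?m = "\<lambda>z. cnj (fst z ^ j * snd z ^ k) * \<omega> z"
  let ?G = "\<lambda>z. F z * cnj (fst z ^ j * snd z ^ k) * \<omega> z"
  let ?H = "\<lambda>z. taylor_fst j F (snd z) * fst z ^ j * cnj (fst z ^ j * snd z ^ k) * \<omega> z"
  let ?K = "\<lambda>z. taylor2 j k F * (fst z ^ j * snd z ^ k * cnj (fst z ^ j * snd z ^ k) * \<omega> z)"
  have Gc: "continuous_on \<Omega> ?G" by (intro continuous_intros Fc \<omega>c)
  have Gav: "integral {0..1} (\<lambda>t. ?G (?c t * fst z, snd z)) = ?H z" if z: "z \<in> \<Omega>" for z
  proof -
    have "?G (?c t * fst z, snd z) = F (?c t * fst z, snd z) * cnj (?c t) ^ j * ?m z" for t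
      unfolding fst_conv snd_conv \<omega>r by (simp add: power_mult_distrib mult_ac)
    then have "integral {0..1} (\<lambda>t. ?G (?c t * fst z, snd z)) =
        integral {0..1} (\<lambda>t. F (?c t * fst z, snd z) * cnj (?c t) ^ j) * ?m z"
      by (simp only: integral_mult_left)
    also have "\<dots> = taylor_fst j F (snd z) * fst z ^ j * ?m z"
      using circle_mean_eq_taylor_coeff[OF open_slice_fst holomorphic2_on_imp_holomorphic_fst[OF F] slice_fst_cball[OF z], of j]
      by (simp only: taylor_fst_def)
    finally show ?thesis by (simp only: mult.assoc)
  qed
  have Hint: "set_integrable lborel \<Omega> ?H"
    by (rule iffD1[OF set_integrable_cong[OF refl refl Gav] average_rotation_fst(1)[OF Gc int]])
  have tc: "continuous_on {w. (0, w) \<in> \<Omega>} (taylor_fst j F)"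
    by (rule holomorphic_on_imp_continuous_on[OF taylor_fst_holomorphic[OF F]])
  have Hc: "continuous_on \<Omega> ?H"
    using slice_snd_cball_0 by (intro continuous_intros \<omega>c continuous_on_compose2[OF tc]) (auto simp: subset_iff)
  have Hav: "integral {0..1} (\<lambda>t. ?H (fst z, ?c t * snd z)) = ?K z" if z: "z \<in> \<Omega>" for z
  proof -
    have "?H (fst z, ?c t * snd z) = taylor_fst j F (?c t * snd z) * cnj (?c t) ^ k * (fst z ^ j * ?m z)" for t
      unfolding fst_conv snd_conv \<omega>r by (simp add: power_mult_distrib mult_ac)
    then have "integral {0..1} (\<lambda>t. ?H (fst z, ?c t * snd z)) =
        integral {0..1} (\<lambda>t. taylor_fst j F (?c t * snd z) * cnj (?c t) ^ k) * (fst z ^ j * ?m z)"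
      by (simp only: integral_mult_left)
    also have "\<dots> = taylor2 j k F * snd z ^ k * (fst z ^ j * ?m z)"
      using circle_mean_eq_taylor_coeff[OF open_slice_snd taylor_fst_holomorphic[OF F] slice_snd_cball_0[OF z], of j k]
      by (simp only: taylor2_def)
    finally show ?thesis by (simp add: mult_ac)
  qed
  have "(LINT z:\<Omega>|lborel. ?G z) = (LINT z:\<Omega>|lborel. integral {0..1} (\<lambda>t. ?G (?c t * fst z, snd z)))"
    by (rule average_rotation_fst(2)[OF Gc int, symmetric])
  also have "\<dots> = (LINT z:\<Omega>|lborel. ?H z)"
    using open_dom Gav by (intro set_lebesgue_integral_cong) auto
  also have "\<dots> = (LINT z:\<Omega>|lborel. integral {0..1} (\<lambda>t. ?H (fst z, ?c t * snd z)))"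
    by (rule average_rotation_snd(2)[OF Hc Hint, symmetric])
  also have "\<dots> = (LINT z:\<Omega>|lborel. ?K z)"
    using open_dom Hav by (intro set_lebesgue_integral_cong) auto
  finally show ?thesis by simp
qed

text \<open>Here the integrand has positive frequency \<open>l - j\<close> in the first variable, so every circle mean
  vanishes.\<close>

lemma moment_eq_0_fst:
  assumes F: "holomorphic2_on F \<Omega>" and \<omega>: "radial \<omega>" and l: "j < l"
    and int: "set_integrable lborel \<Omega> (\<lambda>z. F z * fst z ^ l * cnj (fst z ^ j * snd z ^ k) * \<omega> z)"
  shows "(LINT z:\<Omega>|lborel. F z * fst z ^ l * cnj (fst z ^ j * snd z ^ k) * \<omega> z) = 0"
proof -
  let ?c = "\<lambda>t. cis (2 * pi * t)"
  let ?G = "\<lambda>z. F z * fst z ^ l * cnj (fst z ^ j * snd z ^ k) * \<omega> z"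
  note Fc = holomorphic2_on_imp_continuous_on[OF F]
  have \<omega>c: "continuous_on \<Omega> \<omega>" using \<omega> continuous_on_subset unfolding radial_def by blast
  have \<omega>r: "\<omega> (?c t * fst z, snd z) = \<omega> z" for t z
    using \<omega> by (simp_all add: radial_def)
  have Gc: "continuous_on \<Omega> ?G" by (intro continuous_intros Fc \<omega>c)
  have cl: "?c t ^ l * cnj (?c t) ^ j = ?c t ^ (l - j)" for t
  proof -
    have "?c t * cnj (?c t) = 1" by (metis complex_norm_square norm_cis of_real_1 power_one)
    moreover have "?c t ^ l = ?c t ^ (l - j) * ?c t ^ j" using l by (simp flip: power_add)
    ultimately show ?thesis by (simp add: mult.assoc flip: power_mult_distrib)
  qed
  have Gav: "integral {0..1} (\<lambda>t. ?G (?c t * fst z, snd z)) = 0" if z: "z \<in> \<Omega>" for z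
  proof -
    have "?G (?c t * fst z, snd z) = F (?c t * fst z, snd z) * ?c t ^ (l - j) *
        (fst z ^ l * cnj (fst z ^ j * snd z ^ k) * \<omega> z)" for t
      unfolding cl[symmetric] fst_conv snd_conv \<omega>r by (simp add: power_mult_distrib mult_ac)
    then have "integral {0..1} (\<lambda>t. ?G (?c t * fst z, snd z)) =
        integral {0..1} (\<lambda>t. F (?c t * fst z, snd z) * ?c t ^ (l - j)) *
        (fst z ^ l * cnj (fst z ^ j * snd z ^ k) * \<omega> z)"
      by (simp only: integral_mult_left)
    also have "integral {0..1} (\<lambda>t. F (?c t * fst z, snd z) * ?c t ^ (l - j)) = 0"
      using circle_mean_eq_0[OF open_slice_fst holomorphic2_on_imp_holomorphic_fst[OF F] slice_fst_cball[OF z], of "l - j"] l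
      by simp
    finally show ?thesis by simp
  qed
  have "(LINT z:\<Omega>|lborel. ?G z) = (LINT z:\<Omega>|lborel. integral {0..1} (\<lambda>t. ?G (?c t * fst z, snd z)))"
    by (rule average_rotation_fst(2)[OF Gc int, symmetric])
  also have "\<dots> = (LINT z:\<Omega>|lborel. 0)"
    using open_dom Gav by (intro set_lebesgue_integral_cong) auto
  finally show ?thesis by (simp add: set_lebesgue_integral_def)
qed

lemma moment_eq_0_snd:
  assumes F: "holomorphic2_on F \<Omega>" and \<omega>: "radial \<omega>" and l: "k < l"
    and int: "set_integrable lborel \<Omega> (\<lambda>z. F z * snd z ^ l * cnj (fst z ^ j * snd z ^ k) * \<omega> z)"
  shows "(LINT z:\<Omega>|lborel. F z * snd z ^ l * cnj (fst z ^ j * snd z ^ k) * \<omega> z) = 0"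
proof -
  let ?c = "\<lambda>t. cis (2 * pi * t)"
  let ?G = "\<lambda>z. F z * snd z ^ l * cnj (fst z ^ j * snd z ^ k) * \<omega> z"
  note Fc = holomorphic2_on_imp_continuous_on[OF F]
  have \<omega>c: "continuous_on \<Omega> \<omega>" using \<omega> continuous_on_subset unfolding radial_def by blast
  have \<omega>r: "\<omega> (fst z, ?c t * snd z) = \<omega> z" for t z
    using \<omega> by (simp_all add: radial_def)
  have Gc: "continuous_on \<Omega> ?G" by (intro continuous_intros Fc \<omega>c)
  have cl: "?c t ^ l * cnj (?c t) ^ k = ?c t ^ (l - k)" for t
  proof -
    have "?c t * cnj (?c t) = 1" by (metis complex_norm_square norm_cis of_real_1 power_one)
    moreover have "?c t ^ l = ?c t ^ (l - k) * ?c t ^ k" using l by (simp flip: power_add)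
    ultimately show ?thesis by (simp add: mult.assoc flip: power_mult_distrib)
  qed
  have Gav: "integral {0..1} (\<lambda>t. ?G (fst z, ?c t * snd z)) = 0" if z: "z \<in> \<Omega>" for z
  proof -
    have "?G (fst z, ?c t * snd z) = F (fst z, ?c t * snd z) * ?c t ^ (l - k) *
        (snd z ^ l * cnj (fst z ^ j * snd z ^ k) * \<omega> z)" for t
      unfolding cl[symmetric] fst_conv snd_conv \<omega>r by (simp add: power_mult_distrib mult_ac)
    then have "integral {0..1} (\<lambda>t. ?G (fst z, ?c t * snd z)) =
        integral {0..1} (\<lambda>t. F (fst z, ?c t * snd z) * ?c t ^ (l - k)) *
        (snd z ^ l * cnj (fst z ^ j * snd z ^ k) * \<omega> z)"
      by (simp only: integral_mult_left)
    also have "integral {0..1} (\<lambda>t. F (fst z, ?c t * snd z) * ?c t ^ (l - k)) = 0"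
      using circle_mean_eq_0[OF open_slice_snd holomorphic2_on_imp_holomorphic_snd[OF F] slice_snd_cball[OF z], of "l - k"] l
      by simp
    finally show ?thesis by simp
  qed
  have "(LINT z:\<Omega>|lborel. ?G z) = (LINT z:\<Omega>|lborel. integral {0..1} (\<lambda>t. ?G (fst z, ?c t * snd z)))"
    by (rule average_rotation_snd(2)[OF Gc int, symmetric])
  also have "\<dots> = (LINT z:\<Omega>|lborel. 0)"
    using open_dom Gav by (intro set_lebesgue_integral_cong) auto
  finally show ?thesis by (simp add: set_lebesgue_integral_def)
qed

end

section \<open>Square-integrable functions\<close>

lemma lebesgue_on_open_continuous:
  fixes F :: "'a::euclidean_space \<Rightarrow> 'b::euclidean_space"
  assumes "open \<Omega>" "continuous_on \<Omega> F"
  shows "integrable (lebesgue_on \<Omega>) F \<longleftrightarrow> set_integrable lborel \<Omega> F"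
    and "(LINT z|lebesgue_on \<Omega>. F z) = (LINT z:\<Omega>|lborel. F z)"
    and "F \<in> borel_measurable (lebesgue_on \<Omega>)"
proof -
  have m: "(\<lambda>z. indicator \<Omega> z *\<^sub>R F z) \<in> borel_measurable lborel"
    using borel_measurable_continuous_on_indicator[OF _ assms(2)] assms(1) by simp
  show "integrable (lebesgue_on \<Omega>) F \<longleftrightarrow> set_integrable lborel \<Omega> F"
    using assms(1) m by (simp add: integrable_restrict_space set_integrable_def integrable_completion)
  show "(LINT z|lebesgue_on \<Omega>. F z) = (LINT z:\<Omega>|lborel. F z)"
    using assms(1) m by (simp add: integral_restrict_space set_lebesgue_integral_def integral_completion)
  show "F \<in> borel_measurable (lebesgue_on \<Omega>)"
    using assms by (intro continuous_imp_measurable_on_sets_lebesgue) auto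
qed

lemma set_integrable_continuous_bounded:
  fixes F :: "'a::euclidean_space \<Rightarrow> 'b::euclidean_space"
  assumes "open \<Omega>" "bounded \<Omega>" "continuous_on UNIV F"
  shows "set_integrable lborel \<Omega> F"
proof -
  have "set_integrable lborel (closure \<Omega>) F"
    unfolding set_integrable_def
    using assms by (intro borel_integrable_compact continuous_on_subset[OF assms(3)]) auto
  then show ?thesis
    by (rule set_integrable_subset) (use assms closure_subset in auto)
qed

lemma L2_continuous:
  assumes "open \<Omega>" "bounded \<Omega>" "continuous_on UNIV F"
  shows "F \<in> L2 \<Omega>"
proof -
  have sq: "continuous_on UNIV (\<lambda>z. (cmod (F z))\<^sup>2)" using assms by (intro continuous_intros)
  have "integrable (lebesgue_on \<Omega>) (\<lambda>z. (cmod (F z))\<^sup>2)"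
    using lebesgue_on_open_continuous(1)[OF assms(1) continuous_on_subset[OF sq subset_UNIV]]
      set_integrable_continuous_bounded[OF assms(1,2) sq] by (rule iffD2)
  then show ?thesis
    using lebesgue_on_open_continuous(3)[OF assms(1) continuous_on_subset[OF assms(3) subset_UNIV]]
    by (simp add: L2_def)
qed

lemma L2_measurable: "F \<in> L2 \<Omega> \<Longrightarrow> F \<in> borel_measurable (lebesgue_on \<Omega>)"
  by (simp add: L2_def)

lemma L2_diff:
  assumes "F \<in> L2 \<Omega>" "G \<in> L2 \<Omega>"
  shows "(\<lambda>z. F z - G z) \<in> L2 \<Omega>"
proof -
  note [measurable] = L2_measurable[OF assms(1)] L2_measurable[OF assms(2)]
  have "integrable (lebesgue_on \<Omega>) (\<lambda>z. (cmod (F z - G z))\<^sup>2)"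
  proof (rule Bochner_Integration.integrable_bound)
    show "integrable (lebesgue_on \<Omega>) (\<lambda>z. 2 * (cmod (F z))\<^sup>2 + 2 * (cmod (G z))\<^sup>2)"
      using assms by (simp add: L2_def)
    have "(cmod (F z - G z))\<^sup>2 \<le> 2 * (cmod (F z))\<^sup>2 + 2 * (cmod (G z))\<^sup>2" for z
    proof -
      have "(cmod (F z - G z))\<^sup>2 \<le> (cmod (F z) + cmod (G z))\<^sup>2"
        by (intro power_mono norm_triangle_ineq4) auto
      also have "\<dots> \<le> 2 * (cmod (F z))\<^sup>2 + 2 * (cmod (G z))\<^sup>2"
        using sum_squares_bound[of "cmod (F z)" "cmod (G z)"] by (simp add: power2_sum)
      finally show ?thesis .
    qed
    then show "AE z in lebesgue_on \<Omega>. norm ((cmod (F z - G z))\<^sup>2) \<le>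
        norm (2 * (cmod (F z))\<^sup>2 + 2 * (cmod (G z))\<^sup>2)"
      by simp
  qed simp
  then show ?thesis by (simp add: L2_def)
qed

lemma L2_mult_continuous:
  assumes F: "F \<in> L2 \<Omega>" and "open \<Omega>" "bounded \<Omega>" and b: "continuous_on UNIV b"
  shows "(\<lambda>z. F z * b z) \<in> L2 \<Omega>"
proof -
  have "bounded (b ` closure \<Omega>)"
    using assms by (intro compact_imp_bounded compact_continuous_image continuous_on_subset[OF b]) auto
  then obtain K where K: "\<And>z. z \<in> closure \<Omega> \<Longrightarrow> cmod (b z) \<le> K"
    by (auto simp: bounded_iff)
  have [measurable]: "F \<in> borel_measurable (lebesgue_on \<Omega>)" "b \<in> borel_measurable (lebesgue_on \<Omega>)"
    by (rule L2_measurable[OF F], rule lebesgue_on_open_continuous(3)[OF \<open>open \<Omega>\<close> continuous_on_subset[OF b subset_UNIV]])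
  have "integrable (lebesgue_on \<Omega>) (\<lambda>z. (cmod (F z * b z))\<^sup>2)"
  proof (rule Bochner_Integration.integrable_bound)
    show "integrable (lebesgue_on \<Omega>) (\<lambda>z. K\<^sup>2 * (cmod (F z))\<^sup>2)"
      using F by (simp add: L2_def)
    have "(cmod (F z * b z))\<^sup>2 \<le> K\<^sup>2 * (cmod (F z))\<^sup>2" if "z \<in> \<Omega>" for z
    proof -
      have "cmod (b z) \<le> K" using K that closure_subset by blast
      then have "(cmod (b z))\<^sup>2 \<le> K\<^sup>2" by (intro power_mono) auto
      then have "(cmod (b z))\<^sup>2 * (cmod (F z))\<^sup>2 \<le> K\<^sup>2 * (cmod (F z))\<^sup>2"
        by (intro mult_right_mono) auto
      then show ?thesis by (simp add: norm_mult power_mult_distrib mult.commute)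
    qed
    then show "AE z in lebesgue_on \<Omega>. norm ((cmod (F z * b z))\<^sup>2) \<le> norm (K\<^sup>2 * (cmod (F z))\<^sup>2)"
      by (intro AE_I2) (simp add: space_restrict_space)
  qed simp
  then show ?thesis by (simp add: L2_def)
qed

lemma L2_cnj: "F \<in> L2 \<Omega> \<Longrightarrow> (\<lambda>z. cnj (F z)) \<in> L2 \<Omega>"
  by (auto simp: L2_def intro: measurable_compose[OF _ borel_measurable_continuous_onI[of cnj]] continuous_intros)

lemma L2_integrable_mult:
  assumes "F \<in> L2 \<Omega>" "G \<in> L2 \<Omega>"
  shows "integrable (lebesgue_on \<Omega>) (\<lambda>z. F z * G z)"
proof -
  note [measurable] = L2_measurable[OF assms(1)] L2_measurable[OF assms(2)]
  show ?thesis
  proof (rule Bochner_Integration.integrable_bound)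
    show "integrable (lebesgue_on \<Omega>) (\<lambda>z. (cmod (F z))\<^sup>2 + (cmod (G z))\<^sup>2)"
      using assms by (simp add: L2_def)
    have "cmod (F z * G z) \<le> (cmod (F z))\<^sup>2 + (cmod (G z))\<^sup>2" for z
    proof -
      have "2 * (cmod (F z) * cmod (G z)) \<le> (cmod (F z))\<^sup>2 + (cmod (G z))\<^sup>2"
        using sum_squares_bound[of "cmod (F z)" "cmod (G z)"] by simp
      moreover have "0 \<le> cmod (F z) * cmod (G z)" by simp
      ultimately show ?thesis unfolding norm_mult by linarith
    qed
    then show "AE z in lebesgue_on \<Omega>. cmod (F z * G z) \<le> norm ((cmod (F z))\<^sup>2 + (cmod (G z))\<^sup>2)"
      by simp
  qed simp
qed

lemma L2_integrable_mult_cnj: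
  "F \<in> L2 \<Omega> \<Longrightarrow> G \<in> L2 \<Omega> \<Longrightarrow> integrable (lebesgue_on \<Omega>) (\<lambda>z. F z * cnj (G z))"
  by (intro L2_integrable_mult L2_cnj)

lemma L2_Cauchy_Schwarz:
  assumes "F \<in> L2 \<Omega>" "G \<in> L2 \<Omega>"
  shows "cmod (L2_inner \<Omega> F G) \<le> L2_norm \<Omega> F * L2_norm \<Omega> G"
proof -
  let ?M = "lebesgue_on \<Omega>"
  note [measurable] = L2_measurable[OF assms(1)] L2_measurable[OF assms(2)]
  define I where "I = (LINT z|?M. cmod (F z) * cmod (G z))"
  define A where "A = (LINT z|?M. (cmod (F z))\<^sup>2)"
  define B where "B = (LINT z|?M. (cmod (G z))\<^sup>2)"
  have int: "integrable ?M (\<lambda>z. cmod (F z) * cmod (G z))"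
    using integrable_norm[OF L2_integrable_mult[OF assms]] by (simp add: norm_mult)
  have nonneg: "I \<ge> 0" "A \<ge> 0" "B \<ge> 0" by (simp_all add: I_def A_def B_def)
  have "(\<integral>\<^sup>+z. ennreal (cmod (F z)) * ennreal (cmod (G z)) \<partial>?M)\<^sup>2 \<le>
     (\<integral>\<^sup>+z. ennreal (cmod (F z)) ^ 2 \<partial>?M) * (\<integral>\<^sup>+z. ennreal (cmod (G z)) ^ 2 \<partial>?M)"
    by (rule Cauchy_Schwarz_nn_integral) measurable
  moreover have "(\<integral>\<^sup>+z. ennreal (cmod (F z)) * ennreal (cmod (G z)) \<partial>?M) = ennreal I"
    using nn_integral_eq_integral[OF int] by (simp add: I_def ennreal_mult)
  moreover have "(\<integral>\<^sup>+z. ennreal (cmod (F z)) ^ 2 \<partial>?M) = ennreal A"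
    using nn_integral_eq_integral[of ?M "\<lambda>z. (cmod (F z))\<^sup>2"] assms(1) by (simp add: A_def L2_def ennreal_power)
  moreover have "(\<integral>\<^sup>+z. ennreal (cmod (G z)) ^ 2 \<partial>?M) = ennreal B"
    using nn_integral_eq_integral[of ?M "\<lambda>z. (cmod (G z))\<^sup>2"] assms(2) by (simp add: B_def L2_def ennreal_power)
  ultimately have "ennreal (I\<^sup>2) \<le> ennreal (A * B)"
    using nonneg by (simp add: ennreal_power ennreal_mult)
  then have "I\<^sup>2 \<le> A * B" using nonneg by (simp add: ennreal_le_iff)
  then have "I \<le> sqrt (A * B)" by (rule real_le_rsqrt)
  moreover have "cmod (L2_inner \<Omega> F G) \<le> I"
    unfolding L2_inner_def I_def using integral_norm_bound[of ?M "\<lambda>z. F z * cnj (G z)"] by (simp add: norm_mult)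
  ultimately show ?thesis by (simp add: L2_norm_def A_def B_def real_sqrt_mult)
qed

section \<open>Lower bounds for norms of monomials\<close>

text \<open>At least three quarters of the mass of \<open>|z|\<^sup>2\<^sup>m\<close> on a disc lies in the outer annulus
  \<open>r/2 \<le> |z| < r\<close>, where the factor \<open>|z|\<^sup>2\<^sup>j\<close> is at least \<open>(r/2)\<^sup>2\<^sup>j\<close>. The point of the
  bound is that its constant does not depend on \<open>m\<close>.\<close>

lemma disc_moment_lower_bound:
  fixes r :: real
  assumes r: "0 < r"
  shows "3 / 4 * (r / 2) ^ (2 * j) * (LINT z:ball 0 r|lborel. cmod z ^ (2 * m)) \<le>
     (LINT z:ball 0 r|lborel. cmod z ^ (2 * (j + m)))"
proof -
  define A where "A = ball (0::complex) (r / 2)"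
  define B where "B = ball (0::complex) r - A"
  have AB: "ball 0 r = A \<union> B" "A \<inter> B = {}" using r by (auto simp: A_def B_def)
  have sets[measurable]: "A \<in> sets lborel" "B \<in> sets lborel" by (simp_all add: A_def B_def)
  have intb: "set_integrable lborel (ball 0 r) (\<lambda>z::complex. cmod z ^ n)" for n
    by (intro set_integrable_continuous_bounded continuous_intros) auto
  have intA: "set_integrable lborel A (\<lambda>z. cmod z ^ n)" and intB: "set_integrable lborel B (\<lambda>z. cmod z ^ n)" for n
    using AB sets by (blast intro: set_integrable_subset[OF intb])+
  have split: "(LINT z:ball 0 r|lborel. cmod z ^ n) =
     (LINT z:A|lborel. cmod z ^ n) + (LINT z:B|lborel. cmod z ^ n)" for n
    unfolding AB(1) by (rule set_integral_Un[OF AB(2) intA intB])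
  have nonneg: "(LINT z:S|lborel. cmod z ^ n) \<ge> 0" for S :: "complex set" and n
    by (auto simp: set_lebesgue_integral_def intro!: Bochner_Integration.integral_nonneg)
  have finA: "emeasure lborel A < \<infinity>" unfolding A_def by (rule emeasure_bounded_finite) simp
  have finB: "emeasure lborel B < \<infinity>" unfolding B_def by (rule emeasure_bounded_finite) (rule bounded_diff[OF bounded_ball])
  have constA: "set_integrable lborel A (\<lambda>z. c)" and constB: "set_integrable lborel B (\<lambda>z. c)" for c :: real
    unfolding set_integrable_def
    by (intro integrable_scaleR_left integrable_real_indicator sets finA finB)+
  have mA: "measure lborel A = measure lborel (ball (0::complex) r) / 4"
    using r by (simp add: A_def content_ball power2_eq_square)
  have mB: "measure lborel B = 3 * measure lborel A"
    unfolding B_def using r mA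
      emeasure_bounded_finite[OF bounded_ball, of "0 :: complex" r]
    by (subst measure_Diff) (auto simp: A_def)
  have "(LINT z:A|lborel. cmod z ^ (2 * m)) \<le> (LINT z:A|lborel. (r / 2) ^ (2 * m))"
    by (rule set_integral_mono[OF intA constA]) (auto simp: A_def intro!: power_mono)
  also have "\<dots> = measure lborel A * (r / 2) ^ (2 * m)"
    using finA by (simp add: set_lebesgue_integral_def)
  also have "\<dots> = (LINT z:B|lborel. (r / 2) ^ (2 * m)) / 3"
    using finB by (simp add: set_lebesgue_integral_def mB)
  also have "\<dots> \<le> (LINT z:B|lborel. cmod z ^ (2 * m)) / 3"
    by (intro divide_right_mono set_integral_mono[OF constB intB])
       (use r in \<open>auto simp: B_def A_def intro!: power_mono\<close>)
  finally have "(LINT z:ball 0 r|lborel. cmod z ^ (2 * m)) \<le> 4 / 3 * (LINT z:B|lborel. cmod z ^ (2 * m))"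
    by (simp add: split)
  then have "3 / 4 * (r / 2) ^ (2 * j) * (LINT z:ball 0 r|lborel. cmod z ^ (2 * m)) \<le>
      3 / 4 * (r / 2) ^ (2 * j) * (4 / 3 * (LINT z:B|lborel. cmod z ^ (2 * m)))"
    by (rule mult_left_mono) (use r in auto)
  also have "\<dots> = (LINT z:B|lborel. (r / 2) ^ (2 * j) * cmod z ^ (2 * m))"
    by simp
  also have "\<dots> \<le> (LINT z:B|lborel. cmod z ^ (2 * (j + m)))"
  proof (rule set_integral_mono[OF set_integrable_mult_right[OF intB] intB])
    fix z assume "z \<in> B"
    then have "(r / 2) ^ (2 * j) \<le> cmod z ^ (2 * j)"
      using r by (intro power_mono) (auto simp: B_def A_def)
    then show "(r / 2) ^ (2 * j) * cmod z ^ (2 * m) \<le> cmod z ^ (2 * (j + m))"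
      unfolding distrib_left power_add by (intro mult_right_mono) auto
  qed
  also have "\<dots> \<le> (LINT z:ball 0 r|lborel. cmod z ^ (2 * (j + m)))"
    using nonneg[of A] by (simp add: split)
  finally show ?thesis .
qed

text \<open>The smaller disc may replace the larger one only in the absence of the weight
  \<open>|z|\<^sup>2\<^sup>m\<close>, whose mass drifts to the boundary of the larger disc as \<open>m\<close> grows.\<close>

lemma disc_moment_lower_bound':
  fixes r R :: real
  assumes r: "0 < r" "r \<le> R" and m: "r = R \<or> m = 0"
  shows "3 / 4 * (r / 2) ^ (2 * j) * (r / R)\<^sup>2 * (LINT z:ball 0 R|lborel. cmod z ^ (2 * m)) \<le>
     (LINT z:ball 0 r|lborel. cmod z ^ (2 * (j + m)))"
proof -
  have "(r / R)\<^sup>2 * (LINT z:ball 0 R|lborel. cmod z ^ (2 * m)) = (LINT z:ball 0 r|lborel. cmod z ^ (2 * m))"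
  proof (cases "r = R")
    case False
    with m have "m = 0" by simp
    then show ?thesis using r
      by (simp add: set_lebesgue_integral_def content_ball power_divide emeasure_lborel_ball_finite)
  qed (use r in simp)
  then show ?thesis using disc_moment_lower_bound[OF r(1), of j m] by (simp add: mult.assoc)
qed

lemma set_integral_Times:
  fixes \<phi> \<psi> :: "'a::euclidean_space \<Rightarrow> real"
  assumes A: "open A" "bounded A" "continuous_on UNIV \<phi>" and B: "open B" "bounded B" "continuous_on UNIV \<psi>"
  shows "(LINT z:A \<times> B|lborel. \<phi> (fst z) * \<psi> (snd z)) = (LINT x:A|lborel. \<phi> x) * (LINT y:B|lborel. \<psi> y)"
proof -
  let ?f = "\<lambda>z. indicator (A \<times> B) z *\<^sub>R (\<phi> (fst z) * \<psi> (snd z)) :: real"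
  have "set_integrable lborel (A \<times> B) (\<lambda>z. \<phi> (fst z) * \<psi> (snd z))"
    using A B by (intro set_integrable_continuous_bounded open_Times bounded_Times continuous_intros
       continuous_on_compose2[OF A(3)] continuous_on_compose2[OF B(3)]) auto
  then have int: "integrable (lborel \<Otimes>\<^sub>M lborel) ?f" by (simp add: set_integrable_def lborel_prod)
  have "(LINT z:A \<times> B|lborel. \<phi> (fst z) * \<psi> (snd z)) = (LINT z|(lborel \<Otimes>\<^sub>M lborel). ?f z)"
    by (simp add: set_lebesgue_integral_def lborel_prod)
  also have "\<dots> = (LINT x|lborel. LINT y|lborel. ?f (x, y))"
    by (rule lborel_pair.integral_fst'[OF int, symmetric])
  also have "\<dots> = (LINT x|lborel. LINT y|lborel. (indicator A x *\<^sub>R \<phi> x) * (indicator B y *\<^sub>R \<psi> y))"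
    by (simp add: indicator_times mult_ac)
  also have "\<dots> = (LINT x:A|lborel. \<phi> x) * (LINT y:B|lborel. \<psi> y)"
    by (simp add: set_lebesgue_integral_def)
  finally show ?thesis .
qed

text \<open>This is where the geometry of the boundary acts. An exponent may go to infinity in a variable
  in which the inner and the outer polydisc have the same radius; multiplication by a fixed
  monomial then shrinks norms by no more than a fixed factor.\<close>

lemma monomial_norm_lower_bound:
  fixes \<Omega> :: "(complex \<times> complex) set"
  assumes "open \<Omega>" and r: "0 < r" "r \<le> R" and s: "0 < s" "s \<le> S"
    and sub: "ball 0 r \<times> ball 0 s \<subseteq> \<Omega>" and sup: "\<Omega> \<subseteq> ball 0 R \<times> ball 0 S"
  obtains c where "c > 0"
    "\<And>a b :: nat. r = R \<or> a = 0 \<Longrightarrow> s = S \<or> b = 0 \<Longrightarrow>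
       c * (LINT z:\<Omega>|lborel. (cmod (fst z ^ a * snd z ^ b))\<^sup>2) \<le>
       (LINT z:\<Omega>|lborel. (cmod (fst z ^ (j + a) * snd z ^ (k + b)))\<^sup>2)"
proof
  define C where "C = 3 / 4 * (r / 2) ^ (2 * j) * (r / R)\<^sup>2"
  define D where "D = 3 / 4 * (s / 2) ^ (2 * k) * (s / S)\<^sup>2"
  have CD: "C > 0" "D > 0" using r s by (simp_all add: C_def D_def)
  then show "C * D > 0" by simp
  fix a b :: nat assume a: "r = R \<or> a = 0" and b: "s = S \<or> b = 0"
  have bd: "bounded (ball (0::complex) x \<times> ball (0::complex) y)" for x y by (intro bounded_Times bounded_ball)
  have int: "set_integrable lborel U (\<lambda>z. (cmod (fst z ^ n * snd z ^ m))\<^sup>2)"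
    if "open U" "U \<subseteq> ball 0 x \<times> ball 0 y" for U x y and n m :: nat
    using that bounded_subset[OF bd that(2)]
    by (intro set_integrable_continuous_bounded continuous_intros) auto
  have mono: "(LINT z:U|lborel. (cmod (fst z ^ n * snd z ^ m))\<^sup>2) \<le> (LINT z:V|lborel. (cmod (fst z ^ n * snd z ^ m))\<^sup>2)"
    if "U \<subseteq> V" "open U" "open V" "V \<subseteq> ball 0 x \<times> ball 0 y" for U V x y and n m :: nat
    unfolding set_lebesgue_integral_def
  proof (rule integral_mono)
    show "integrable lborel (\<lambda>z. indicat_real U z *\<^sub>R (cmod (fst z ^ n * snd z ^ m))\<^sup>2)"
      "integrable lborel (\<lambda>z. indicat_real V z *\<^sub>R (cmod (fst z ^ n * snd z ^ m))\<^sup>2)"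
      using int[of U x y n m] int[of V x y n m] that by (auto simp: set_integrable_def)
  qed (use that in \<open>auto simp: indicator_def\<close>)
  have prod: "(LINT z:ball 0 x \<times> ball 0 y|lborel. (cmod (fst z ^ n * snd z ^ m))\<^sup>2) =
     (LINT z:ball 0 x|lborel. cmod z ^ (2 * n)) * (LINT z:ball 0 y|lborel. cmod z ^ (2 * m))" for x y n m
  proof -
    have "(cmod (fst z ^ n * snd z ^ m))\<^sup>2 = cmod (fst z) ^ (2 * n) * cmod (snd z) ^ (2 * m)"
      for z :: "complex \<times> complex"
      by (simp add: norm_mult norm_power power_mult_distrib mult.commute flip: power_mult)
    then show ?thesis
      using set_integral_Times[of "ball 0 x" "\<lambda>z. cmod z ^ (2 * n)" "ball 0 y" "\<lambda>z. cmod z ^ (2 * m)"]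
      by (simp add: continuous_intros)
  qed
  have nonneg: "(LINT z:U|lborel. cmod z ^ n) \<ge> 0" for U :: "complex set" and n
    by (auto simp: set_lebesgue_integral_def intro!: Bochner_Integration.integral_nonneg)
  have "C * D * (LINT z:\<Omega>|lborel. (cmod (fst z ^ a * snd z ^ b))\<^sup>2) \<le>
     C * D * (LINT z:ball 0 R \<times> ball 0 S|lborel. (cmod (fst z ^ a * snd z ^ b))\<^sup>2)"
    using CD mono[OF sup assms(1) _ subset_refl] by (intro mult_left_mono) (auto intro: open_Times)
  also have "\<dots> = (C * (LINT z:ball 0 R|lborel. cmod z ^ (2 * a))) * (D * (LINT z:ball 0 S|lborel. cmod z ^ (2 * b)))"
    by (simp add: prod)
  also have "\<dots> \<le> (LINT z:ball 0 r|lborel. cmod z ^ (2 * (j + a))) * (LINT z:ball 0 s|lborel. cmod z ^ (2 * (k + b)))"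
    unfolding C_def D_def using CD nonneg
    by (intro mult_mono disc_moment_lower_bound' r s a b) (auto simp: C_def D_def intro!: mult_nonneg_nonneg)
  also have "\<dots> = (LINT z:ball 0 r \<times> ball 0 s|lborel. (cmod (fst z ^ (j + a) * snd z ^ (k + b)))\<^sup>2)"
    by (simp add: prod)
  also have "\<dots> \<le> (LINT z:\<Omega>|lborel. (cmod (fst z ^ (j + a) * snd z ^ (k + b)))\<^sup>2)"
    by (rule mono[OF sub _ assms(1) sup]) (auto intro: open_Times)
  finally show "C * D * (LINT z:\<Omega>|lborel. (cmod (fst z ^ a * snd z ^ b))\<^sup>2) \<le>
       (LINT z:\<Omega>|lborel. (cmod (fst z ^ (j + a) * snd z ^ (k + b)))\<^sup>2)" .
qed

section \<open>The Bergman projection on conjugate symbols times powers\<close>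

definition mon :: "nat \<Rightarrow> nat \<Rightarrow> complex \<times> complex \<Rightarrow> complex" where
  "mon a b z = fst z ^ a * snd z ^ b"

lemma mon_mult: "mon a b z * mon c d z = mon (a + c) (b + d) z"
  by (simp add: mon_def power_add mult_ac)

lemma mon_0_0: "mon 0 0 z = 1"
  by (simp add: mon_def)

lemma continuous_on_mon: "continuous_on S (mon a b)"
  unfolding mon_def by (intro continuous_intros)

lemma holomorphic2_on_mon: "holomorphic2_on (mon a b) S"
  unfolding mon_def by (intro holomorphic2_intros)

lemma taylor_coeff_mult:
  assumes "open U" "f holomorphic_on U" "g holomorphic_on U" "0 \<in> U"
  shows "(deriv ^^ n) (\<lambda>w. f w * g w) 0 / fact n =
    (\<Sum>i\<le>n. ((deriv ^^ i) f 0 / fact i) * ((deriv ^^ (n - i)) g 0 / fact (n - i)))"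
proof -
  have "of_nat (n choose i) / fact n = 1 / (fact i * fact (n - i) :: complex)" if "i \<le> n" for i
    by (subst binomial_fact[OF that]) simp
  then have "of_nat (n choose i) * x * y / fact n = (x / fact i) * (y / fact (n - i))"
    if "i \<le> n" for i and x y :: complex
    using that by (simp add: field_simps)
  then show ?thesis
    unfolding higher_deriv_mult[OF assms(2,3,1,4)] atMost_atLeast0 sum_divide_distrib
    by (intro sum.cong) auto
qed

context complete_reinhardt
begin

lemma radial_cmod_mon: "radial (\<lambda>z. of_real ((cmod (mon a b z))\<^sup>2))"
  unfolding radial_def mon_def
  by (auto simp: norm_mult norm_power intro!: continuous_intros)

text \<open>The pair \<open>(p, q)\<close> selects an axis: the powers \<open>z\<^sub>1\<^sup>n\<close> for \<open>(1, 0)\<close> and \<open>z\<^sub>2\<^sup>n\<close> for \<open>(0, 1)\<close>.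
  Along an axis the Taylor coefficients of a product are given by the Cauchy product in one
  variable.\<close>

lemma taylor2_axis_mult:
  assumes F: "holomorphic2_on F \<Omega>" and G: "holomorphic2_on G \<Omega>"
    and pq: "p = 1 \<and> q = 0 \<or> p = 0 \<and> q = (1 :: nat)"
  shows "taylor2 (p * n) (q * n) (\<lambda>z. F z * G z) =
    (\<Sum>i\<le>n. taylor2 (p * i) (q * i) F * taylor2 (p * (n - i)) (q * (n - i)) G)"
  using pq
proof
  assume "p = 1 \<and> q = 0"
  then show ?thesis
    using taylor_coeff_mult[OF open_slice_fst[of 0] holomorphic2_on_imp_holomorphic_fst[OF F]
        holomorphic2_on_imp_holomorphic_fst[OF G]] zero_mem
    by (simp add: taylor2_def taylor_fst_def)
next
  assume "p = 0 \<and> q = 1"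
  moreover have "taylor_fst 0 H = (\<lambda>w. H (0, w))" for H
    by (simp add: taylor_fst_def fun_eq_iff)
  ultimately show ?thesis
    using taylor_coeff_mult[OF open_slice_snd[of 0] holomorphic2_on_imp_holomorphic_snd[OF F]
        holomorphic2_on_imp_holomorphic_snd[OF G]] zero_mem
    by (simp add: taylor2_def)
qed

end

locale bounded_complete_reinhardt = complete_reinhardt +
  assumes bounded_dom: "bounded \<Omega>"
begin

lemma bergman_space_continuous: "f \<in> bergman_space \<Omega> \<Longrightarrow> continuous_on \<Omega> f"
  by (auto simp: bergman_space_def intro: holomorphic2_on_imp_continuous_on)

lemma mon_L2: "mon a b \<in> L2 \<Omega>"
  by (rule L2_continuous[OF open_dom bounded_dom continuous_on_mon])

lemma mon_bergman: "mon a b \<in> bergman_space \<Omega>"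
  by (simp add: bergman_space_def mon_L2 holomorphic2_on_mon)

lemma L2_mult_mon: "F \<in> L2 \<Omega> \<Longrightarrow> (\<lambda>z. F z * mon a b z) \<in> L2 \<Omega>"
  by (rule L2_mult_continuous[OF _ open_dom bounded_dom continuous_on_mon])

definition sqnorm :: "nat \<Rightarrow> nat \<Rightarrow> real" where
  "sqnorm a b = (LINT z|lebesgue_on \<Omega>. (cmod (mon a b z))\<^sup>2)"

lemma sqnorm_lborel: "sqnorm a b = (LINT z:\<Omega>|lborel. (cmod (mon a b z))\<^sup>2)"
  unfolding sqnorm_def
  by (rule lebesgue_on_open_continuous(2)[OF open_dom]) (intro continuous_intros continuous_on_mon)

lemma sqnorm_complex: "(LINT z|lebesgue_on \<Omega>. mon a b z * cnj (mon a b z)) = of_real (sqnorm a b)"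
  unfolding sqnorm_def by (simp flip: integral_complex_of_real complex_norm_square)

lemma polydisc_bounds:
  obtains r R where "0 < r" "r \<le> R" "ball 0 r \<times> ball 0 r \<subseteq> \<Omega>" "\<Omega> \<subseteq> ball 0 R \<times> ball 0 R"
proof -
  obtain A B where AB: "open A" "open B" "0 \<in> A" "0 \<in> B" "A \<times> B \<subseteq> \<Omega>"
    using open_dom zero_mem open_prod_elim by (metis SigmaE2)
  obtain r1 where r1: "r1 > 0" "ball 0 r1 \<subseteq> A" using AB open_contains_ball by blast
  obtain r2 where r2: "r2 > 0" "ball 0 r2 \<subseteq> B" using AB open_contains_ball by blast
  obtain K where K: "\<And>z. z \<in> \<Omega> \<Longrightarrow> norm z < K" "K > 0"
    using bounded_dom bounded_pos_less by metis
  define r where "r = min r1 r2"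
  define R where "R = max r K"
  have "\<Omega> \<subseteq> ball 0 R \<times> ball 0 R"
  proof
    fix z assume "z \<in> \<Omega>"
    then have "norm z < R" using K(1)[of z] by (simp add: R_def)
    then show "z \<in> ball 0 R \<times> ball 0 R"
      using norm_fst_le[of "fst z" "snd z"] norm_snd_le[of "snd z" "fst z"] by (cases z) auto
  qed
  moreover have "ball 0 r \<times> ball 0 r \<subseteq> \<Omega>"
    using r1 r2 AB by (auto simp: r_def subset_iff)
  ultimately show ?thesis using that[of r R] r1 r2 by (simp add: r_def R_def)
qed

lemma sqnorm_pos: "sqnorm j k > 0"
proof -
  obtain r R where r: "0 < r" "r \<le> R" "ball 0 r \<times> ball 0 r \<subseteq> \<Omega>" "\<Omega> \<subseteq> ball 0 R \<times> ball 0 R"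
    by (rule polydisc_bounds)
  \<comment> \<open>The monomial is compared with the constant 1, for which any two polydiscs will do.\<close>
  obtain c where c: "c > 0" "\<And>a b :: nat. r = R \<or> a = 0 \<Longrightarrow> r = R \<or> b = 0 \<Longrightarrow>
       c * (LINT z:\<Omega>|lborel. (cmod (fst z ^ a * snd z ^ b))\<^sup>2) \<le>
       (LINT z:\<Omega>|lborel. (cmod (fst z ^ (j + a) * snd z ^ (k + b)))\<^sup>2)"
    using monomial_norm_lower_bound[OF open_dom r(1,2,1-4), of j k] by blast
  have "measure lborel \<Omega> > 0"
  proof -
    obtain e where e: "e > 0" "ball (0, 0) e \<subseteq> \<Omega>"
      using open_dom zero_mem open_contains_ball by blast
    have "0 < measure lborel (ball (0 :: complex \<times> complex) e)" using e(1) by simp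
    also have "\<dots> \<le> measure lborel \<Omega>"
      using e(2) open_dom emeasure_bounded_finite[OF bounded_dom]
      by (intro measure_mono_fmeasurable) (auto simp: fmeasurable_def zero_prod_def)
    finally show ?thesis .
  qed
  moreover have "(LINT z:\<Omega>|lborel. (cmod (fst z ^ 0 * snd z ^ 0))\<^sup>2) = measure lborel \<Omega>"
    using open_dom emeasure_bounded_finite[OF bounded_dom] by (simp add: set_lebesgue_integral_def)
  ultimately have "0 < c * (LINT z:\<Omega>|lborel. (cmod (fst z ^ 0 * snd z ^ 0))\<^sup>2)"
    using c(1) by simp
  also have "\<dots> \<le> (LINT z:\<Omega>|lborel. (cmod (fst z ^ (j + 0) * snd z ^ (k + 0)))\<^sup>2)"
    by (rule c(2)) auto
  finally show ?thesis by (simp add: sqnorm_lborel mon_def)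
qed

lemma integral_mult_cnj_mon:
  assumes F: "holomorphic2_on F \<Omega>" and int: "integrable (lebesgue_on \<Omega>) F"
  shows "(LINT z|lebesgue_on \<Omega>. F z * cnj (mon a b z)) = taylor2 a b F * of_real (sqnorm a b)"
proof -
  have rad: "radial (\<lambda>z. 1)" by (simp add: radial_def)
  have Fc: "continuous_on \<Omega> F" by (rule holomorphic2_on_imp_continuous_on[OF F])
  let ?G = "\<lambda>z. F z * cnj (fst z ^ a * snd z ^ b) * 1"
  have Gc: "continuous_on \<Omega> ?G" by (intro continuous_intros Fc)
  have bd: "bounded (mon a b ` \<Omega>)"
  proof -
    have "bounded (mon a b ` closure \<Omega>)"
      using bounded_dom by (intro compact_imp_bounded compact_continuous_image continuous_on_mon) auto
    then show ?thesis by (rule bounded_subset) (use closure_subset in blast)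
  qed
  then obtain K where K: "\<And>z. z \<in> \<Omega> \<Longrightarrow> cmod (mon a b z) \<le> K" by (auto simp: bounded_iff)
  have "integrable (lebesgue_on \<Omega>) ?G"
  proof (rule Bochner_Integration.integrable_bound)
    show "integrable (lebesgue_on \<Omega>) (\<lambda>z. K * cmod (F z))" using int by simp
    show "?G \<in> borel_measurable (lebesgue_on \<Omega>)" by (rule lebesgue_on_open_continuous(3)[OF open_dom Gc])
    have "cmod (?G z) \<le> norm (K * cmod (F z))" if "z \<in> \<Omega>" for z
    proof -
      have "cmod (?G z) = cmod (mon a b z) * cmod (F z)" by (simp add: mon_def norm_mult norm_power mult_ac)
      also have "\<dots> \<le> K * cmod (F z)" by (rule mult_right_mono[OF K[OF that]]) simp
      finally show ?thesis by simp
    qed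
    then show "AE z in lebesgue_on \<Omega>. cmod (?G z) \<le> norm (K * cmod (F z))"
      by (intro AE_I2) (simp add: space_restrict_space)
  qed
  then have "set_integrable lborel \<Omega> ?G"
    using lebesgue_on_open_continuous(1)[OF open_dom Gc] by simp
  from moment_eq_taylor2[OF F rad this]
  have "(LINT z|lebesgue_on \<Omega>. ?G z) = taylor2 a b F * (LINT z:\<Omega>|lborel. mon a b z * cnj (mon a b z))"
    using lebesgue_on_open_continuous(2)[OF open_dom Gc] by (simp add: mon_def)
  also have "(LINT z:\<Omega>|lborel. mon a b z * cnj (mon a b z)) = of_real (sqnorm a b)"
    using lebesgue_on_open_continuous(2)[OF open_dom, of "\<lambda>z. mon a b z * cnj (mon a b z)"]
    by (simp add: sqnorm_complex continuous_intros continuous_on_mon)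
  finally show ?thesis by (simp add: mon_def)
qed

text \<open>The projection is defined by a choice, so a function with the defining property has to be
  exhibited. With \<open>e\<^sub>i\<close> the \<open>i\<close>-th power of the selected coordinate and \<open>a\<^sub>i\<close> the coefficient of
  \<open>e\<^sub>i\<close> in \<open>f\<close>, it is the polynomial
  \<open>\<Sum>i\<le>n. cnj a\<^sub>i \<parallel>e\<^sub>n\<parallel>\<^sup>2 / \<parallel>e\<^sub>n\<^sub>-\<^sub>i\<parallel>\<^sup>2 e\<^sub>n\<^sub>-\<^sub>i\<close>.
  Indeed the inner product of \<open>g\<close> with \<open>cnj f e\<^sub>n\<close> is the moment of \<open>f g\<close> against \<open>e\<^sub>n\<close>, hence
  the \<open>n\<close>-th coefficient of \<open>f g\<close> along the axis times \<open>\<parallel>e\<^sub>n\<parallel>\<^sup>2\<close>, which involves only finitely many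
  coefficients of \<open>g\<close>.\<close>

lemma bergman_projection_cnj_mult_mon:
  assumes f: "f \<in> bergman_space \<Omega>" and pq: "p = 1 \<and> q = 0 \<or> p = 0 \<and> q = (1 :: nat)"
    and u_def: "u = (\<lambda>z. cnj (f z) * mon (p * n) (q * n) z)"
  shows "bergman_projection \<Omega> u \<in> bergman_space \<Omega>"
proof -
  let ?N = "\<lambda>i. complex_of_real (sqnorm (p * i) (q * i))"
  let ?C = "\<lambda>i F. taylor2 (p * i) (q * i) F"
  let ?e = "\<lambda>i. mon (p * i) (q * i)"
  \<comment> \<open>The factor compensates for the change of norm from \<open>e\<^sub>n\<close> to \<open>e\<^sub>n\<^sub>-\<^sub>i\<close>.\<close>
  define c where "c i = cnj (?C i f) * (?N n / ?N (n - i))" for i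
  define h where "h z = (\<Sum>i\<le>n. c i * ?e (n - i) z)" for z
  have N0: "?N i \<noteq> 0" for i using sqnorm_pos[of "p * i" "q * i"] by simp
  have fL: "f \<in> L2 \<Omega>" "holomorphic2_on f \<Omega>" using f by (auto simp: bergman_space_def)
  have "h \<in> bergman_space \<Omega>"
    unfolding bergman_space_def h_def
    by (auto intro!: holomorphic2_intros holomorphic2_on_mon L2_continuous open_dom bounded_dom
        continuous_intros continuous_on_mon)
  moreover have "L2_inner \<Omega> (\<lambda>z. u z - h z) g = 0" if g: "g \<in> bergman_space \<Omega>" for g
  proof -
    have gL: "g \<in> L2 \<Omega>" "holomorphic2_on g \<Omega>" using g by (auto simp: bergman_space_def)
    have fg: "holomorphic2_on (\<lambda>z. f z * g z) \<Omega>" "integrable (lebesgue_on \<Omega>) (\<lambda>z. f z * g z)"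
      using fL gL by (auto intro: holomorphic2_on_mult L2_integrable_mult)
    have uL: "u \<in> L2 \<Omega>" unfolding u_def by (intro L2_mult_mon L2_cnj fL)
    have gi: "integrable (lebesgue_on \<Omega>) g"
      using L2_integrable_mult[OF gL(1) mon_L2[of 0 0]] by (simp add: mon_0_0)
    have eg: "integrable (lebesgue_on \<Omega>) (\<lambda>z. ?e i z * cnj (g z))" for i
      by (intro L2_integrable_mult_cnj mon_L2 gL)
    have egi: "(LINT z|lebesgue_on \<Omega>. ?e i z * cnj (g z)) = cnj (?C i g) * ?N i" for i
    proof -
      have "(LINT z|lebesgue_on \<Omega>. ?e i z * cnj (g z)) = (LINT z|lebesgue_on \<Omega>. cnj (g z * cnj (?e i z)))"
        by (simp add: mult.commute)
      also have "\<dots> = cnj (?C i g * ?N i)"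
        by (simp only: Bochner_Integration.integral_cnj integral_mult_cnj_mon[OF gL(2) gi])
      finally show ?thesis by simp
    qed
    have "(LINT z|lebesgue_on \<Omega>. u z * cnj (g z)) = (LINT z|lebesgue_on \<Omega>. cnj ((f z * g z) * cnj (?e n z)))"
      by (simp add: u_def mult_ac)
    also have "\<dots> = cnj (?C n (\<lambda>z. f z * g z) * ?N n)"
      by (simp only: Bochner_Integration.integral_cnj integral_mult_cnj_mon[OF fg])
    also have "\<dots> = (\<Sum>i\<le>n. cnj (?C i f) * cnj (?C (n - i) g)) * ?N n"
      by (simp add: taylor2_axis_mult[OF fL(2) gL(2) pq])
    also have "\<dots> = (\<Sum>i\<le>n. c i * (cnj (?C (n - i) g) * ?N (n - i)))"
      unfolding sum_distrib_right c_def by (intro sum.cong) (use N0 in auto)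
    also have "\<dots> = (\<Sum>i\<le>n. c i * (LINT z|lebesgue_on \<Omega>. ?e (n - i) z * cnj (g z)))"
      by (simp only: egi)
    also have "\<dots> = (LINT z|lebesgue_on \<Omega>. (\<Sum>i\<le>n. c i * (?e (n - i) z * cnj (g z))))"
      using eg by (subst Bochner_Integration.integral_sum) auto
    also have "\<dots> = (LINT z|lebesgue_on \<Omega>. h z * cnj (g z))"
      by (simp add: h_def sum_distrib_right mult.assoc)
    finally have eq: "(LINT z|lebesgue_on \<Omega>. u z * cnj (g z)) = (LINT z|lebesgue_on \<Omega>. h z * cnj (g z))" .
    have "L2_inner \<Omega> (\<lambda>z. u z - h z) g = (LINT z|lebesgue_on \<Omega>. u z * cnj (g z) - h z * cnj (g z))"
      by (simp add: L2_inner_def left_diff_distrib)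
    also have "\<dots> = 0"
      using uL \<open>h \<in> bergman_space \<Omega>\<close> gL eq
      by (subst Bochner_Integration.integral_diff) (auto simp: bergman_space_def intro: L2_integrable_mult_cnj)
    finally show ?thesis .
  qed
  ultimately have "\<exists>h. h \<in> bergman_space \<Omega> \<and> (\<forall>g\<in>bergman_space \<Omega>. L2_inner \<Omega> (\<lambda>z. u z - h z) g = 0)"
    by blast
  from someI_ex[OF this]
  show "bergman_projection \<Omega> u \<in> bergman_space \<Omega>"
    unfolding bergman_projection_def by blast
qed

end

section \<open>Compactness annihilates Taylor coefficients\<close>

context bounded_complete_reinhardt
begin

text \<open>Multiplication by \<open>e\<^sub>n cnj e\<^sub>n\<close> is a radial weight, so the diagonal moment reads off the
  coefficient of the symbol. Off the diagonal there remains a factor \<open>e\<^sub>n\<^sub>-\<^sub>m\<close>, and for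
  \<open>n - m > j + k\<close> its frequency exceeds that of \<open>z\<^sub>1\<^sup>j z\<^sub>2\<^sup>k\<close>.\<close>

lemma integral_symbol_shifted_mon:
  assumes f: "f \<in> bergman_space \<Omega>" and pq: "p = 1 \<and> q = 0 \<or> p = 0 \<and> q = (1 :: nat)"
  shows "(LINT z|lebesgue_on \<Omega>. f z * cnj (mon j k z) * (mon (p * n) (q * n) z * cnj (mon (p * n) (q * n) z))) =
      taylor2 j k f * of_real (sqnorm (j + p * n) (k + q * n))"
    and "m + j + k < n \<Longrightarrow>
      (LINT z|lebesgue_on \<Omega>. f z * cnj (mon j k z) * (mon (p * n) (q * n) z * cnj (mon (p * m) (q * m) z))) = 0"
proof -
  have fL: "f \<in> L2 \<Omega>" "holomorphic2_on f \<Omega>" using f by (auto simp: bergman_space_def)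
  have fc: "continuous_on \<Omega> f" by (rule bergman_space_continuous[OF f])
  have int: "integrable (lebesgue_on \<Omega>) (\<lambda>z. f z * mon a b z * cnj (mon c d z))" for a b c d
    by (intro L2_integrable_mult_cnj L2_mult_mon mon_L2 fL)
  let ?w = "\<lambda>m z. complex_of_real ((cmod (mon (p * m) (q * m) z))\<^sup>2)"
  have w: "mon (p * m) (q * m) z * cnj (mon (p * m) (q * m) z) = ?w m z" for m z
    by (simp add: complex_norm_square[symmetric])
  { let ?G = "\<lambda>z. f z * cnj (fst z ^ j * snd z ^ k) * ?w n z"
    have Gc: "continuous_on \<Omega> ?G" by (intro continuous_intros fc continuous_on_mon)
    have "?G = (\<lambda>z. f z * mon (p * n) (q * n) z * cnj (mon (j + p * n) (k + q * n) z))"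
      unfolding w[symmetric] mon_mult[symmetric] by (simp add: mon_def mult_ac)
    then have "integrable (lebesgue_on \<Omega>) ?G" by (simp only: int)
    then have Gi: "set_integrable lborel \<Omega> ?G" using lebesgue_on_open_continuous(1)[OF open_dom Gc] by simp
    have "(LINT z|lebesgue_on \<Omega>. f z * cnj (mon j k z) * (mon (p * n) (q * n) z * cnj (mon (p * n) (q * n) z))) =
       (LINT z:\<Omega>|lborel. ?G z)"
      unfolding w mon_def[of j k] by (rule lebesgue_on_open_continuous(2)[OF open_dom Gc])
    also have "\<dots> = taylor2 j k f * (LINT z:\<Omega>|lborel. fst z ^ j * snd z ^ k * cnj (fst z ^ j * snd z ^ k) * ?w n z)"
      by (rule moment_eq_taylor2[OF fL(2) radial_cmod_mon Gi])
    also have "(\<lambda>z. fst z ^ j * snd z ^ k * cnj (fst z ^ j * snd z ^ k) * ?w n z) =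
       (\<lambda>z. mon (j + p * n) (k + q * n) z * cnj (mon (j + p * n) (k + q * n) z))"
      unfolding w[symmetric] mon_mult[symmetric] by (simp add: mon_def mult_ac)
    also have "(LINT z:\<Omega>|lborel. mon (j + p * n) (k + q * n) z * cnj (mon (j + p * n) (k + q * n) z)) =
       of_real (sqnorm (j + p * n) (k + q * n))"
      unfolding sqnorm_complex[symmetric]
      by (rule lebesgue_on_open_continuous(2)[OF open_dom, symmetric]) (intro continuous_intros continuous_on_mon)
    finally show "(LINT z|lebesgue_on \<Omega>. f z * cnj (mon j k z) * (mon (p * n) (q * n) z * cnj (mon (p * n) (q * n) z))) =
      taylor2 j k f * of_real (sqnorm (j + p * n) (k + q * n))" . }
  { assume mn: "m + j + k < n"
    let ?G = "\<lambda>z. f z * mon (p * (n - m)) (q * (n - m)) z * cnj (fst z ^ j * snd z ^ k) * ?w m z"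
    have Gc: "continuous_on \<Omega> ?G" by (intro continuous_intros fc continuous_on_mon)
    have nm: "p * n = p * (n - m) + p * m" "q * n = q * (n - m) + q * m"
      using mn by (simp_all flip: distrib_left)
    have eq: "f z * cnj (mon j k z) * (mon (p * n) (q * n) z * cnj (mon (p * m) (q * m) z)) = ?G z" for z
      unfolding w[symmetric] nm mon_mult[symmetric] by (simp add: mon_def mult_ac)
    have "?G = (\<lambda>z. f z * mon (p * n) (q * n) z * cnj (mon (j + p * m) (k + q * m) z))"
      unfolding eq[symmetric] mon_mult[symmetric] by (simp add: mult_ac)
    then have "integrable (lebesgue_on \<Omega>) ?G" by (simp only: int)
    then have Gi: "set_integrable lborel \<Omega> ?G" using lebesgue_on_open_continuous(1)[OF open_dom Gc] by simp
    have "(LINT z|lebesgue_on \<Omega>. f z * cnj (mon j k z) * (mon (p * n) (q * n) z * cnj (mon (p * m) (q * m) z))) =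
        (LINT z:\<Omega>|lborel. ?G z)"
      unfolding eq by (rule lebesgue_on_open_continuous(2)[OF open_dom Gc])
    also have "\<dots> = 0"
      using pq
    proof
      assume "p = 1 \<and> q = 0"
      then show ?thesis
        using moment_eq_0_fst[OF fL(2) radial_cmod_mon, of j "n - m" k "p * m" "q * m"] Gi mn
        by (simp add: mon_def)
    next
      assume "p = 0 \<and> q = 1"
      then show ?thesis
        using moment_eq_0_snd[OF fL(2) radial_cmod_mon, of k "n - m" j "p * m" "q * m"] Gi mn
        by (simp add: mon_def)
    qed
    finally show "(LINT z|lebesgue_on \<Omega>. f z * cnj (mon j k z) * (mon (p * n) (q * n) z * cnj (mon (p * m) (q * m) z))) = 0" . }
qed

text \<open>The function \<open>cnj (z\<^sub>1\<^sup>j z\<^sub>2\<^sup>k)\<close> times a power of one coordinate has a negative weight under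
  rotation of the other coordinate, and no holomorphic function has such a component.\<close>

lemma bergman_orthogonal_test:
  assumes g: "g \<in> bergman_space \<Omega>"
    and pq: "p = 1 \<and> q = 0 \<and> 0 < k \<or> p = 0 \<and> q = (1 :: nat) \<and> 0 < j"
  shows "(LINT z|lebesgue_on \<Omega>. g z * mon j k z * cnj (mon (p * n) (q * n) z)) = 0"
proof -
  have gL: "g \<in> L2 \<Omega>" "holomorphic2_on g \<Omega>" using g by (auto simp: bergman_space_def)
  have rad: "radial (\<lambda>z. 1)" by (simp add: radial_def)
  let ?G = "\<lambda>z. g z * mon j k z * cnj (mon (p * n) (q * n) z)"
  have Gc: "continuous_on \<Omega> ?G"
    by (intro continuous_intros bergman_space_continuous[OF g] continuous_on_mon)
  have "integrable (lebesgue_on \<Omega>) ?G"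
    by (intro L2_integrable_mult_cnj L2_mult_mon mon_L2 gL)
  then have Gi: "set_integrable lborel \<Omega> ?G"
    using lebesgue_on_open_continuous(1)[OF open_dom Gc] by simp
  have "(LINT z:\<Omega>|lborel. ?G z) = 0"
    using pq
  proof
    assume pq: "p = 1 \<and> q = 0 \<and> 0 < k"
    have h: "holomorphic2_on (\<lambda>z. g z * fst z ^ j) \<Omega>" by (intro holomorphic2_intros gL)
    have eq: "?G z = g z * fst z ^ j * snd z ^ k * cnj (fst z ^ n * snd z ^ 0) * 1" for z
      using pq by (simp add: mon_def mult_ac)
    show ?thesis
      using moment_eq_0_snd[OF h rad, of 0 k n] pq Gi unfolding eq by simp
  next
    assume pq: "p = 0 \<and> q = 1 \<and> 0 < j"
    have h: "holomorphic2_on (\<lambda>z. g z * snd z ^ k) \<Omega>" by (intro holomorphic2_intros gL)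
    have eq: "?G z = g z * snd z ^ k * fst z ^ j * cnj (fst z ^ 0 * snd z ^ n) * 1" for z
      using pq by (simp add: mon_def mult_ac)
    show ?thesis
      using moment_eq_0_fst[OF h rad, of 0 j n] pq Gi unfolding eq by simp
  qed
  then show ?thesis using lebesgue_on_open_continuous(2)[OF open_dom Gc] by simp
qed

text \<open>The projection part of the Hankel operator disappears against a test function orthogonal to
  the Bergman space, which leaves a moment of the symbol.\<close>

lemma hankel_test_pairing:
  assumes f: "f \<in> bergman_space \<Omega>"
    and pq: "p = 1 \<and> q = 0 \<and> 0 < k \<or> p = 0 \<and> q = (1 :: nat) \<and> 0 < j"
  defines "e \<equiv> \<lambda>n. mon (p * n) (q * n)"
  shows "L2_inner \<Omega> (hankel \<Omega> (\<lambda>z. cnj (f z)) (e m)) (\<lambda>z. cnj (mon j k z) * e n z) =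
     cnj (LINT z|lebesgue_on \<Omega>. f z * cnj (mon j k z) * (e n z * cnj (e m z)))"
proof -
  let ?h = "bergman_projection \<Omega> (\<lambda>z. cnj (f z) * e m z)"
  have e_eq: "e i = mon (p * i) (q * i)" for i by (simp add: e_def)
  have fL: "f \<in> L2 \<Omega>" using f by (simp add: bergman_space_def)
  have h: "?h \<in> bergman_space \<Omega>"
    unfolding e_def by (rule bergman_projection_cnj_mult_mon[OF f _ refl]) (use pq in auto)
  have hL: "?h \<in> L2 \<Omega>" using h by (simp add: bergman_space_def)
  have "L2_inner \<Omega> (hankel \<Omega> (\<lambda>z. cnj (f z)) (e m)) (\<lambda>z. cnj (mon j k z) * e n z) =
     (LINT z|lebesgue_on \<Omega>. cnj (f z * cnj (mon j k z) * (e n z * cnj (e m z))) - ?h z * mon j k z * cnj (e n z))"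
    unfolding L2_inner_def hankel_def by (intro Bochner_Integration.integral_cong refl) (simp add: algebra_simps)
  also have "\<dots> = (LINT z|lebesgue_on \<Omega>. cnj (f z * cnj (mon j k z) * (e n z * cnj (e m z)))) -
      (LINT z|lebesgue_on \<Omega>. ?h z * mon j k z * cnj (e n z))"
  proof (rule Bochner_Integration.integral_diff)
    have "integrable (lebesgue_on \<Omega>) (\<lambda>z. (f z * e n z) * cnj (mon j k z * e m z))"
      unfolding e_def by (intro L2_integrable_mult_cnj L2_mult_mon mon_L2 fL)
    then have "integrable (lebesgue_on \<Omega>) (\<lambda>z. f z * cnj (mon j k z) * (e n z * cnj (e m z)))"
      by (simp add: mult_ac)
    then show "integrable (lebesgue_on \<Omega>) (\<lambda>z. cnj (f z * cnj (mon j k z) * (e n z * cnj (e m z))))"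
      by (rule integrable_cnj)
    show "integrable (lebesgue_on \<Omega>) (\<lambda>z. ?h z * mon j k z * cnj (e n z))"
      unfolding e_eq[of n] by (intro L2_integrable_mult_cnj L2_mult_mon mon_L2 hL)
  qed
  also have "(LINT z|lebesgue_on \<Omega>. ?h z * mon j k z * cnj (e n z)) = 0"
    unfolding e_eq[of n] by (rule bergman_orthogonal_test[OF h pq])
  finally show ?thesis by (simp only: Bochner_Integration.integral_cnj diff_zero)
qed

text \<open>Let \<open>g\<^sub>n\<close> be the normalised powers of the selected coordinate and
  \<open>v\<^sub>n = cnj (z\<^sub>1\<^sup>j z\<^sub>2\<^sup>k) g\<^sub>n\<close>. The pairing of \<open>T g\<^sub>m\<close> with \<open>v\<^sub>n\<close> is \<open>cnj a\<^sub>j\<^sub>k \<parallel>v\<^sub>n\<parallel>\<^sup>2\<close> for \<open>m = n\<close>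
  and 0 for \<open>n > m + j + k\<close>. Compactness makes \<open>T g\<^sub>n\<close> a Cauchy sequence along a subsequence, so
  \<open>|a\<^sub>j\<^sub>k| \<parallel>v\<^sub>n\<parallel>\<^sup>2\<close> tends to 0 there, although \<open>\<parallel>v\<^sub>n\<parallel>\<^sup>2 \<ge> c\<close>.\<close>

lemma compact_hankel_imp_taylor2_eq_0:
  assumes f: "f \<in> bergman_space \<Omega>" and comp: "compact_hankel \<Omega> (\<lambda>z. cnj (f z))"
    and pq: "p = 1 \<and> q = 0 \<and> 0 < k \<or> p = 0 \<and> q = (1 :: nat) \<and> 0 < j"
    and c: "c > 0" and low: "\<And>n. c * sqnorm (p * n) (q * n) \<le> sqnorm (j + p * n) (k + q * n)"
  shows "taylor2 j k f = 0"
proof -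
  let ?\<phi> = "\<lambda>z. cnj (f z)"
  let ?L = "lebesgue_on \<Omega>"
  define e where "e n = mon (p * n) (q * n)" for n
  define N where "N n = sqrt (sqnorm (p * n) (q * n))" for n
  define g where "g n = (\<lambda>z. of_real (1 / N n) * e n z)" for n
  define v where "v n = (\<lambda>z. cnj (mon j k z) * g n z)" for n
  define X where "X n = sqnorm (j + p * n) (k + q * n) / sqnorm (p * n) (q * n)" for n
  have fL: "f \<in> L2 \<Omega>" using f by (simp add: bergman_space_def)
  have Npos: "N n > 0" for n using sqnorm_pos[of "p * n" "q * n"] by (simp add: N_def)
  have Nsq: "N n * N n = sqnorm (p * n) (q * n)" for n
    using sqnorm_pos[of "p * n" "q * n"] by (simp add: N_def)
  have Xge: "c \<le> X n" for n
    using low[of n] sqnorm_pos[of "p * n" "q * n"] by (simp add: X_def field_simps)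
  have eb: "e n \<in> bergman_space \<Omega>" for n by (simp add: e_def mon_bergman)
  have gb: "g n \<in> bergman_space \<Omega>" for n
    unfolding g_def bergman_space_def e_def mem_Collect_eq
    by (intro conjI holomorphic2_intros holomorphic2_on_mon L2_continuous open_dom bounded_dom
        continuous_intros continuous_on_mon)
  have gnorm: "L2_norm \<Omega> (g n) = 1" for n
  proof -
    have "(LINT z|?L. (cmod (g n z))\<^sup>2) = (LINT z|?L. (1 / N n)\<^sup>2 * (cmod (e n z))\<^sup>2)"
      by (simp add: g_def norm_mult power_mult_distrib norm_divide power_divide)
    also have "\<dots> = (1 / N n)\<^sup>2 * sqnorm (p * n) (q * n)" by (simp add: sqnorm_def e_def)
    also have "\<dots> = 1" using Npos[of n] by (simp add: Nsq[symmetric] power2_eq_square)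
    finally show ?thesis by (simp add: L2_norm_def)
  qed
  obtain T where T: "compact_operator \<Omega> T"
    and Text: "\<And>g. g \<in> hankel_dom \<Omega> ?\<phi> \<Longrightarrow> AE z in ?L. T g z = hankel \<Omega> ?\<phi> g z"
    using comp unfolding compact_hankel_def by blast
  have TL: "T g \<in> L2 \<Omega>" if "g \<in> bergman_space \<Omega>" for g
    using T that by (simp add: compact_operator_def)
  have Tscale: "AE z in ?L. T (\<lambda>w. a * g w) z = a * T g z" if "g \<in> bergman_space \<Omega>" for a g
    using T that by (simp add: compact_operator_def)
  have "range g \<subseteq> bergman_space \<Omega> \<and> bounded (range (\<lambda>n. L2_norm \<Omega> (g n)))"
    using gb by (auto simp: gnorm)
  then obtain r h where r: "strict_mono r" and h: "h \<in> L2 \<Omega>"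
    and lim: "(\<lambda>n. L2_norm \<Omega> (\<lambda>z. T (g (r n)) z - h z)) \<longlonglongrightarrow> 0"
    using T unfolding compact_operator_def by blast
  have edom: "e n \<in> hankel_dom \<Omega> ?\<phi>" for n
    unfolding hankel_dom_def using eb by (simp add: e_def L2_mult_mon L2_cnj fL)
  have Tg: "AE z in ?L. T (g n) z = of_real (1 / N n) * hankel \<Omega> ?\<phi> (e n) z" for n
    using Tscale[OF eb[of n], of "of_real (1 / N n)"] Text[OF edom[of n]]
    unfolding g_def by eventually_elim simp
  have hankL: "hankel \<Omega> ?\<phi> (e n) \<in> L2 \<Omega>" for n
  proof -
    have "bergman_projection \<Omega> (\<lambda>z. ?\<phi> z * e n z) \<in> bergman_space \<Omega>"
      unfolding e_def by (rule bergman_projection_cnj_mult_mon[OF f _ refl]) (use pq in auto)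
    then show ?thesis
      unfolding hankel_def e_def by (intro L2_diff L2_mult_mon L2_cnj fL) (simp add: bergman_space_def)
  qed
  have vL: "v n \<in> L2 \<Omega>" for n
    unfolding v_def g_def e_def
    by (intro L2_continuous open_dom bounded_dom continuous_intros continuous_on_mon)
  have pairing: "L2_inner \<Omega> (T (g m)) (v n) = of_real (1 / (N m * N n)) *
      cnj (LINT z|?L. f z * cnj (mon j k z) * (e n z * cnj (e m z)))" for m n
  proof -
    have "L2_inner \<Omega> (T (g m)) (v n) =
       (LINT z|?L. of_real (1 / (N m * N n)) * (hankel \<Omega> ?\<phi> (e m) z * cnj (cnj (mon j k z) * e n z)))"
      unfolding L2_inner_def
    proof (rule integral_cong_AE)
      show "(\<lambda>z. T (g m) z * cnj (v n z)) \<in> borel_measurable ?L"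
        using TL[OF gb] vL by (intro borel_measurable_integrable L2_integrable_mult_cnj)
      have "(\<lambda>z. cnj (mon j k z) * e n z) \<in> L2 \<Omega>"
        unfolding e_def by (intro L2_continuous open_dom bounded_dom continuous_intros continuous_on_mon)
      then have "integrable ?L (\<lambda>z. hankel \<Omega> ?\<phi> (e m) z * cnj (cnj (mon j k z) * e n z))"
        by (rule L2_integrable_mult_cnj[OF hankL])
      then show "(\<lambda>z. of_real (1 / (N m * N n)) * (hankel \<Omega> ?\<phi> (e m) z * cnj (cnj (mon j k z) * e n z)))
         \<in> borel_measurable ?L"
        by (intro borel_measurable_integrable integrable_mult_right)
      show "AE z in ?L. T (g m) z * cnj (v n z) =
          of_real (1 / (N m * N n)) * (hankel \<Omega> ?\<phi> (e m) z * cnj (cnj (mon j k z) * e n z))"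
        using Tg[of m] by eventually_elim (simp add: v_def g_def)
    qed
    also have "\<dots> = of_real (1 / (N m * N n)) *
       L2_inner \<Omega> (hankel \<Omega> ?\<phi> (e m)) (\<lambda>z. cnj (mon j k z) * e n z)"
      by (simp only: L2_inner_def integral_mult_right_zero)
    finally show ?thesis
      unfolding e_def using hankel_test_pairing[OF f pq, of m n] by simp
  qed
  have pq': "p = 1 \<and> q = 0 \<or> p = 0 \<and> q = 1" using pq by blast
  have diag: "L2_inner \<Omega> (T (g n)) (v n) = cnj (taylor2 j k f) * of_real (X n)" for n
    unfolding pairing e_def integral_symbol_shifted_mon(1)[OF f pq'] by (simp add: Nsq X_def)
  have offdiag: "L2_inner \<Omega> (T (g m)) (v n) = 0" if "m + j + k < n" for m n
    unfolding pairing e_def integral_symbol_shifted_mon(2)[OF f pq' that] by simp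
  obtain K where K: "K > 0" "\<And>z. z \<in> \<Omega> \<Longrightarrow> cmod (mon j k z) \<le> K"
  proof -
    have "bounded (mon j k ` closure \<Omega>)"
      using bounded_dom by (intro compact_imp_bounded compact_continuous_image continuous_on_mon) auto
    then obtain B where "B > 0" "\<forall>x\<in>mon j k ` closure \<Omega>. norm x \<le> B" using bounded_pos by blast
    then show ?thesis using that[of B] closure_subset[of \<Omega>] by blast
  qed
  have vnorm: "L2_norm \<Omega> (v n) \<le> K" for n
  proof -
    have gi: "integrable ?L (\<lambda>z. (cmod (g n z))\<^sup>2)" and vi: "integrable ?L (\<lambda>z. (cmod (v n z))\<^sup>2)"
      using gb[of n] vL[of n] by (auto simp: bergman_space_def L2_def)
    have "(LINT z|?L. (cmod (v n z))\<^sup>2) \<le> (LINT z|?L. K\<^sup>2 * (cmod (g n z))\<^sup>2)"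
    proof (rule integral_mono[OF vi integrable_mult_right[OF gi]])
      fix z assume "z \<in> space ?L"
      then have "cmod (mon j k z) \<le> K" using K by (simp add: space_restrict_space)
      then have "(cmod (mon j k z))\<^sup>2 * (cmod (g n z))\<^sup>2 \<le> K\<^sup>2 * (cmod (g n z))\<^sup>2"
        by (intro mult_right_mono power_mono) auto
      then show "(cmod (v n z))\<^sup>2 \<le> K\<^sup>2 * (cmod (g n z))\<^sup>2"
        by (simp add: v_def norm_mult power_mult_distrib)
    qed
    also have "\<dots> = K\<^sup>2" using gnorm[of n] by (simp add: L2_norm_def)
    finally show ?thesis unfolding L2_norm_def using K(1) by (simp add: real_le_lsqrt)
  qed
  define \<delta> where "\<delta> n = L2_norm \<Omega> (\<lambda>z. T (g (r n)) z - h z)" for n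
  have pair_diff: "cmod (L2_inner \<Omega> (T (g (r n))) (v i) - L2_inner \<Omega> h (v i)) \<le> \<delta> n * K" for n i
  proof -
    have "L2_inner \<Omega> (T (g (r n))) (v i) - L2_inner \<Omega> h (v i) = L2_inner \<Omega> (\<lambda>z. T (g (r n)) z - h z) (v i)"
      unfolding L2_inner_def left_diff_distrib
      by (rule Bochner_Integration.integral_diff[symmetric]; intro L2_integrable_mult_cnj TL gb h vL)
    also have "cmod \<dots> \<le> \<delta> n * L2_norm \<Omega> (v i)"
      unfolding \<delta>_def by (intro L2_Cauchy_Schwarz L2_diff TL gb h vL)
    also have "\<dots> \<le> \<delta> n * K"
      by (intro mult_left_mono vnorm) (simp add: \<delta>_def L2_norm_def)
    finally show ?thesis .
  qed
  \<comment> \<open>Subtracting the term with index \<open>m\<close> does not change the pairing, but it cancels the limit \<open>h\<close>.\<close>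
  have bound: "cmod (taylor2 j k f) * c \<le> (\<delta> n + \<delta> m) * K" if "r m + j + k < r n" for m n
  proof -
    have "cmod (taylor2 j k f) * c \<le> cmod (taylor2 j k f) * \<bar>X (r n)\<bar>"
      using Xge[of "r n"] by (intro mult_left_mono) auto
    also have "\<dots> = cmod (L2_inner \<Omega> (T (g (r n))) (v (r n)) - L2_inner \<Omega> (T (g (r m))) (v (r n)))"
      by (simp add: diag offdiag[OF that] norm_mult)
    also have "\<dots> \<le> cmod (L2_inner \<Omega> (T (g (r n))) (v (r n)) - L2_inner \<Omega> h (v (r n))) +
        cmod (L2_inner \<Omega> (T (g (r m))) (v (r n)) - L2_inner \<Omega> h (v (r n)))"
      using norm_triangle_ineq4[of "L2_inner \<Omega> (T (g (r n))) (v (r n)) - L2_inner \<Omega> h (v (r n))"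
         "L2_inner \<Omega> (T (g (r m))) (v (r n)) - L2_inner \<Omega> h (v (r n))"] by simp
    also have "\<dots> \<le> (\<delta> n + \<delta> m) * K"
      using pair_diff[of n "r n"] pair_diff[of m "r n"] by (simp add: distrib_right)
    finally show ?thesis .
  qed
  have \<delta>lim: "\<delta> \<longlonglongrightarrow> 0" using lim by (simp add: \<delta>_def[abs_def])
  have bound': "cmod (taylor2 j k f) * c \<le> (0 + \<delta> m) * K" for m
  proof (rule tendsto_lowerbound)
    show "(\<lambda>n. (\<delta> n + \<delta> m) * K) \<longlonglongrightarrow> (0 + \<delta> m) * K" by (intro tendsto_intros \<delta>lim)
    have "eventually (\<lambda>n. r m + j + k < n) sequentially" by (rule eventually_gt_at_top)
    then show "eventually (\<lambda>n. cmod (taylor2 j k f) * c \<le> (\<delta> n + \<delta> m) * K) sequentially"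
    proof eventually_elim
      case (elim n)
      then show ?case using seq_suble[OF r, of n] by (intro bound) simp
    qed
  qed simp
  have "(\<lambda>m. (0 + \<delta> m) * K) \<longlonglongrightarrow> (0 + 0) * K" by (intro tendsto_intros \<delta>lim)
  then have "cmod (taylor2 j k f) * c \<le> (0 + 0) * K"
    by (rule LIMSEQ_le_const) (use bound' in blast)
  then have "cmod (taylor2 j k f) * c \<le> 0" by simp
  then show ?thesis using c by (simp add: mult_le_0_iff)
qed

end

section \<open>Geometry of convex Reinhardt domains\<close>

lemma convex_combination_of_antipodal:
  fixes z w :: complex
  assumes "cmod w \<le> cmod z"
  obtains \<zeta> t where "cmod \<zeta> = 1" "0 \<le> t" "t \<le> 1" "w = (1 - t) *\<^sub>R (\<zeta> * z) + t *\<^sub>R (- \<zeta> * z)"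
proof (cases "w = 0")
  case True
  have "w = (1 - 1/2) *\<^sub>R (1 * z) + (1/2) *\<^sub>R (- 1 * z)" using True by simp
  then show ?thesis using that[of 1 "1/2"] by simp
next
  case False
  then have z: "z \<noteq> 0" using assms by auto
  define \<zeta> where "\<zeta> = w * of_real (cmod z) / (z * of_real (cmod w))"
  define t where "t = (1 - cmod w / cmod z) / 2"
  have "cmod \<zeta> = 1" using z False by (simp add: \<zeta>_def norm_mult norm_divide)
  moreover have "0 \<le> t" "t \<le> 1" using assms z by (simp_all add: t_def field_simps)
  moreover have "w = (1 - t) *\<^sub>R (\<zeta> * z) + t *\<^sub>R (- \<zeta> * z)"
  proof -
    have "(1 - t) *\<^sub>R (\<zeta> * z) + t *\<^sub>R (- \<zeta> * z) = of_real (1 - 2 * t) * (\<zeta> * z)"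
      by (simp add: scaleR_conv_of_real algebra_simps)
    also have "1 - 2 * t = cmod w / cmod z" by (simp add: t_def field_simps)
    also have "of_real (cmod w / cmod z) * (\<zeta> * z) = w" using z False by (simp add: \<zeta>_def)
    finally show ?thesis by simp
  qed
  ultimately show ?thesis by (rule that)
qed

text \<open>Shrinking the moduli of the coordinates, one at a time, is taking convex combinations of two
  opposite rotations of the same point.\<close>

lemma convex_reinhardt_imp_complete:
  assumes "reinhardt_domain \<Omega>" "convex \<Omega>"
  shows "complete_reinhardt \<Omega>"
proof
  show "open \<Omega>" "\<Omega> \<noteq> {}" using assms(1) by (auto simp: reinhardt_domain_def)
  have rot: "(a * z1, b * z2) \<in> \<Omega>" if "(z1, z2) \<in> \<Omega>" "cmod a = 1" "cmod b = 1" for z1 z2 a b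
    using assms(1) that unfolding reinhardt_domain_def by blast
  fix z1 z2 w1 w2 assume z: "(z1, z2) \<in> \<Omega>" and w: "cmod w1 \<le> cmod z1" "cmod w2 \<le> cmod z2"
  obtain a t where a: "cmod a = 1" "0 \<le> t" "t \<le> 1" "w1 = (1 - t) *\<^sub>R (a * z1) + t *\<^sub>R (- a * z1)"
    using convex_combination_of_antipodal[OF w(1)] .
  obtain b s where b: "cmod b = 1" "0 \<le> s" "s \<le> 1" "w2 = (1 - s) *\<^sub>R (b * z2) + s *\<^sub>R (- b * z2)"
    using convex_combination_of_antipodal[OF w(2)] .
  have w1: "(w1, c * z2) \<in> \<Omega>" if "cmod c = 1" for c
  proof -
    have "(1 - t) *\<^sub>R (a * z1, c * z2) + t *\<^sub>R (- a * z1, c * z2) \<in> \<Omega>"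
      using rot[OF z, of a c] rot[OF z, of "- a" c] a b that by (intro convexD_alt[OF assms(2)]) auto
    then show ?thesis using a by (simp flip: scaleR_add_left)
  qed
  have "(1 - s) *\<^sub>R (w1, b * z2) + s *\<^sub>R (w1, - b * z2) \<in> \<Omega>"
    using w1[of b] w1[of "- b"] b by (intro convexD_alt[OF assms(2)]) auto
  then show "(w1, w2) \<in> \<Omega>" using b by (simp flip: scaleR_add_left)
qed

lemma boundary_discs_subset_frontier: "boundary_discs \<Omega> \<subseteq> frontier \<Omega>"
  unfolding boundary_discs_def by (rule closure_minimal) auto

context complete_reinhardt
begin

text \<open>A disc \<open>{|z\<^sub>1| \<le> r} \<times> {z\<^sub>2}\<close> for each \<open>z\<^sub>2\<close> with \<open>|z\<^sub>2| = s\<close> in the boundary pins the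
  domain between a polydisc and a cylinder of the same radius \<open>s\<close> in the second variable: convexity
  fills in the polydisc, and a point of the domain with \<open>|z\<^sub>2| \<ge> s\<close> would, by completeness, put
  the boundary point \<open>(0, s)\<close> inside the domain.\<close>

lemma disc_in_frontier_fst:
  assumes "convex \<Omega>" and r: "r > 0" and s: "s > 0"
    and sub: "cball 0 r \<times> sphere 0 s \<subseteq> frontier \<Omega>"
  shows "ball 0 r \<times> ball 0 s \<subseteq> \<Omega>" "\<Omega> \<subseteq> UNIV \<times> ball 0 s"
proof -
  have cl: "cball 0 r \<times> sphere 0 s \<subseteq> closure \<Omega>" using sub by (auto simp: frontier_def)
  have "ball 0 r \<times> ball 0 s \<subseteq> closure \<Omega>"
  proof clarify
    fix w1 w2 :: complex assume w: "w1 \<in> ball 0 r" "w2 \<in> ball 0 s"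
    have "cmod w2 \<le> cmod (of_real s)" using w s by simp
    then obtain b t where b: "cmod b = 1" "0 \<le> t" "t \<le> 1"
      "w2 = (1 - t) *\<^sub>R (b * of_real s) + t *\<^sub>R (- b * of_real s)"
      by (rule convex_combination_of_antipodal)
    have "(w1, b * of_real s) \<in> closure \<Omega>" "(w1, - b * of_real s) \<in> closure \<Omega>"
      using w s b by (auto intro!: subsetD[OF cl] simp: norm_mult)
    then have "(1 - t) *\<^sub>R (w1, b * of_real s) + t *\<^sub>R (w1, - b * of_real s) \<in> closure \<Omega>"
      using b by (intro convexD_alt[OF convex_closure[OF assms(1)]]) auto
    then show "(w1, w2) \<in> closure \<Omega>" using b by (simp flip: scaleR_add_left)
  qed
  then have "ball 0 r \<times> ball 0 s \<subseteq> interior (closure \<Omega>)"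
    by (intro interior_maximal open_Times) auto
  then show "ball 0 r \<times> ball 0 s \<subseteq> \<Omega>"
    using open_dom by (simp add: convex_interior_closure[OF assms(1)] interior_open)
  show "\<Omega> \<subseteq> UNIV \<times> ball 0 s"
  proof (intro subsetI)
    fix x assume "x \<in> \<Omega>"
    then obtain z1 z2 where z: "x = (z1, z2)" "(z1, z2) \<in> \<Omega>" by (cases x) auto
    have "z2 \<in> ball 0 s"
    proof (rule ccontr)
      assume "z2 \<notin> ball 0 s"
      then have "(0, of_real s) \<in> \<Omega>" using s by (intro complete[OF z(2)]) auto
      moreover have "(0, of_real s) \<in> frontier \<Omega>" using r s by (intro subsetD[OF sub]) auto
      ultimately show False using open_dom by (simp add: frontier_def interior_open)
    qed
    then show "x \<in> UNIV \<times> ball 0 s" by (simp add: z)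
  qed
qed

lemma disc_in_frontier_snd:
  assumes "convex \<Omega>" and r: "r > 0" and s: "s > 0"
    and sub: "sphere 0 s \<times> cball 0 r \<subseteq> frontier \<Omega>"
  shows "ball 0 s \<times> ball 0 r \<subseteq> \<Omega>" "\<Omega> \<subseteq> ball 0 s \<times> UNIV"
proof -
  have cl: "sphere 0 s \<times> cball 0 r \<subseteq> closure \<Omega>" using sub by (auto simp: frontier_def)
  have "ball 0 s \<times> ball 0 r \<subseteq> closure \<Omega>"
  proof clarify
    fix w1 w2 :: complex assume w: "w1 \<in> ball 0 s" "w2 \<in> ball 0 r"
    have "cmod w1 \<le> cmod (of_real s)" using w s by simp
    then obtain b t where b: "cmod b = 1" "0 \<le> t" "t \<le> 1"
      "w1 = (1 - t) *\<^sub>R (b * of_real s) + t *\<^sub>R (- b * of_real s)"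
      by (rule convex_combination_of_antipodal)
    have "(b * of_real s, w2) \<in> closure \<Omega>" "(- b * of_real s, w2) \<in> closure \<Omega>"
      using w s b by (auto intro!: subsetD[OF cl] simp: norm_mult)
    then have "(1 - t) *\<^sub>R (b * of_real s, w2) + t *\<^sub>R (- b * of_real s, w2) \<in> closure \<Omega>"
      using b by (intro convexD_alt[OF convex_closure[OF assms(1)]]) auto
    then show "(w1, w2) \<in> closure \<Omega>" using b by (simp flip: scaleR_add_left)
  qed
  then have "ball 0 s \<times> ball 0 r \<subseteq> interior (closure \<Omega>)"
    by (intro interior_maximal open_Times) auto
  then show "ball 0 s \<times> ball 0 r \<subseteq> \<Omega>"
    using open_dom by (simp add: convex_interior_closure[OF assms(1)] interior_open)
  show "\<Omega> \<subseteq> ball 0 s \<times> UNIV"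
  proof (intro subsetI)
    fix x assume "x \<in> \<Omega>"
    then obtain z1 z2 where z: "x = (z1, z2)" "(z1, z2) \<in> \<Omega>" by (cases x) auto
    have "z1 \<in> ball 0 s"
    proof (rule ccontr)
      assume "z1 \<notin> ball 0 s"
      then have "(of_real s, 0) \<in> \<Omega>" using s by (intro complete[OF z(2)]) auto
      moreover have "(of_real s, 0) \<in> frontier \<Omega>" using r s by (intro subsetD[OF sub]) auto
      ultimately show False using open_dom by (simp add: frontier_def interior_open)
    qed
    then show "x \<in> ball 0 s \<times> UNIV" by (simp add: z)
  qed
qed

end

section \<open>Vanishing coefficients and constancy\<close>

lemma connected_slice:
  fixes V :: "complex set"
  assumes "0 \<in> V" "\<And>z. z \<in> V \<Longrightarrow> cball 0 (cmod z) \<subseteq> V"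
  shows "connected V"
proof -
  have "closed_segment 0 z \<subseteq> V" if "z \<in> V" for z
  proof -
    have "closed_segment 0 z \<subseteq> cball 0 (cmod z)"
      by (intro closed_segment_subset convex_cball) auto
    then show ?thesis using assms(2)[OF that] by blast
  qed
  then have "starlike V" using assms(1) unfolding starlike_def by blast
  then show ?thesis by (rule starlike_imp_connected)
qed

context complete_reinhardt
begin

text \<open>The identity theorem is applied twice: in the second variable to the coefficient functions
  \<open>taylor_fst j F\<close>, and then in the first variable on each slice.\<close>

lemma constant_if_taylor2_eq_0:
  assumes F: "holomorphic2_on F \<Omega>"
    and 0: "\<And>j k. 0 < j \<or> 0 < k \<Longrightarrow> taylor2 j k F = 0"
  shows "\<forall>z\<in>\<Omega>. F z = F (0, 0)"
proof -
  let ?W = "{w. (0, w) \<in> \<Omega>}"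
  have W: "open ?W" "0 \<in> ?W" using open_slice_snd zero_mem by auto
  have conn: "connected ?W"
    using zero_mem slice_snd_cball[of "(0, _)"] by (intro connected_slice) auto
  have tz: "(deriv ^^ k) (taylor_fst j F) 0 = 0" if "0 < j \<or> 0 < k" for j k
    using 0[OF that] by (simp add: taylor2_def)
  have tf: "taylor_fst j F w = taylor_fst j F 0" if "w \<in> ?W" for j w
    using holomorphic_fun_eq_const_on_connected[OF taylor_fst_holomorphic[OF F] W(1) conn _ W(2) that] tz
    by blast
  have tf0: "taylor_fst j F w = 0" if "0 < j" "w \<in> ?W" for j w
    using tf[OF that(2), of j] tz[of j 0] that by simp
  have slice: "F (z, w) = F (0, w)" if zw: "(z, w) \<in> \<Omega>" for z w
  proof -
    let ?V = "{z. (z, w) \<in> \<Omega>}"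
    have w0: "(0, w) \<in> \<Omega>" by (rule complete[OF zw]) auto
    moreover have "connected ?V"
      using w0 slice_fst_cball[of "(_, w)"] by (intro connected_slice) auto
    moreover have "(deriv ^^ j) (\<lambda>z. F (z, w)) 0 = 0" if "0 < j" for j
      using tf0[OF that, of w] w0 by (simp add: taylor_fst_def)
    ultimately show ?thesis
      using holomorphic_fun_eq_const_on_connected[OF holomorphic2_on_imp_holomorphic_fst[OF F] open_slice_fst, of w 0 z] zw
      by simp
  qed
  have axis: "F (0, w) = F (0, 0)" if "w \<in> ?W" for w
    using tf[OF that, of 0] by (simp add: taylor_fst_def)
  show ?thesis
  proof clarify
    fix z w assume zw: "(z, w) \<in> \<Omega>"
    have "(0, w) \<in> \<Omega>" by (rule complete[OF zw]) auto
    then show "F (z, w) = F (0, 0)" using slice[OF zw] axis by simp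
  qed
qed

end

theorem corollary1:
  fixes \<Omega> \<Gamma>1 \<Gamma>2 :: "(complex \<times> complex) set"
    and f :: "complex \<times> complex \<Rightarrow> complex"
  assumes "reinhardt_domain \<Omega>" and "bounded \<Omega>" and "convex \<Omega>"
    and "disc_decomposition \<Omega> \<Gamma>1 \<Gamma>2" and "\<Gamma>1 \<noteq> {}" and "\<Gamma>2 \<noteq> {}"
    and "f \<in> bergman_space \<Omega>"
    and "compact_hankel \<Omega> (\<lambda>z. cnj (f z))"
  shows "\<exists>c. \<forall>z\<in>\<Omega>. f z = c"
proof -
  interpret bounded_complete_reinhardt \<Omega>
    using convex_reinhardt_imp_complete[OF assms(1,3)] assms(2)
    by (simp add: bounded_complete_reinhardt_def bounded_complete_reinhardt_axioms_def)
  \<comment> \<open>\<open>\<Gamma>1\<close> fixes the radius of \<open>\<Omega>\<close> in the second variable, \<open>\<Gamma>2\<close> that in the first.\<close>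
  obtain r1 s1 where 1: "r1 > 0" "s1 > 0" "\<Gamma>1 = cball 0 r1 \<times> sphere 0 s1"
    using assms(4,5) by (auto simp: disc_decomposition_def)
  obtain r2 s2 where 2: "r2 > 0" "s2 > 0" "\<Gamma>2 = sphere 0 s2 \<times> cball 0 r2"
    using assms(4,6) by (auto simp: disc_decomposition_def)
  have "\<Gamma>1 \<subseteq> frontier \<Omega>" "\<Gamma>2 \<subseteq> frontier \<Omega>"
    using assms(4) boundary_discs_subset_frontier[of \<Omega>] by (auto simp: disc_decomposition_def)
  note sub1 = disc_in_frontier_fst[OF assms(3) 1(1,2) this(1)[unfolded 1(3)]]
    and sub2 = disc_in_frontier_snd[OF assms(3) 2(1,2) this(2)[unfolded 2(3)]]
  have sup: "\<Omega> \<subseteq> ball 0 s2 \<times> ball 0 s1" using sub1(2) sub2(2) by auto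
  have r: "r1 \<le> s2" "r2 \<le> s1"
  proof -
    have "x \<in> ball 0 s2" if "x \<in> ball 0 r1" for x :: complex
      using subsetD[OF sup, of "(x, 0)"] subsetD[OF sub1(1), of "(x, 0)"] that 1 by simp
    moreover have "x \<in> ball 0 s1" if "x \<in> ball 0 r2" for x :: complex
      using subsetD[OF sup, of "(0, x)"] subsetD[OF sub2(1), of "(0, x)"] that 2 by simp
    ultimately have "ball 0 r1 \<subseteq> ball (0 :: complex) s2" "ball 0 r2 \<subseteq> ball (0 :: complex) s1"
      by blast+
    then show "r1 \<le> s2" "r2 \<le> s1" using 1 2 by (auto simp: ball_subset_ball_iff)
  qed
  have "taylor2 j k f = 0" if "0 < j \<or> 0 < k" for j k
    using that
  proof
    \<comment> \<open>Powers of \<open>z\<^sub>2\<close> are the test functions: their mass moves to \<open>|z\<^sub>2| = s1\<close>.\<close>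
    assume j: "0 < j"
    obtain c where c: "c > 0" "\<And>a b :: nat. r1 = s2 \<or> a = 0 \<Longrightarrow> s1 = s1 \<or> b = 0 \<Longrightarrow>
       c * (LINT z:\<Omega>|lborel. (cmod (fst z ^ a * snd z ^ b))\<^sup>2) \<le>
       (LINT z:\<Omega>|lborel. (cmod (fst z ^ (j + a) * snd z ^ (k + b)))\<^sup>2)"
      using monomial_norm_lower_bound[OF open_dom 1(1) r(1) 1(2) order_refl sub1(1) sup, of j k] by blast
    show ?thesis
      by (rule compact_hankel_imp_taylor2_eq_0[OF assms(7,8), of 0 1, OF _ c(1)])
         (use j c(2)[of 0] in \<open>auto simp: sqnorm_lborel mon_def\<close>)
  next
    \<comment> \<open>Powers of \<open>z\<^sub>1\<close> are the test functions: their mass moves to \<open>|z\<^sub>1| = s2\<close>.\<close>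
    assume k: "0 < k"
    obtain c where c: "c > 0" "\<And>a b :: nat. s2 = s2 \<or> a = 0 \<Longrightarrow> r2 = s1 \<or> b = 0 \<Longrightarrow>
       c * (LINT z:\<Omega>|lborel. (cmod (fst z ^ a * snd z ^ b))\<^sup>2) \<le>
       (LINT z:\<Omega>|lborel. (cmod (fst z ^ (j + a) * snd z ^ (k + b)))\<^sup>2)"
      using monomial_norm_lower_bound[OF open_dom 2(2) order_refl 2(1) r(2) sub2(1) sup, of j k] by blast
    show ?thesis
      by (rule compact_hankel_imp_taylor2_eq_0[OF assms(7,8), of 1 0, OF _ c(1)])
         (use k c(2)[of _ 0] in \<open>auto simp: sqnorm_lborel mon_def\<close>)
  qed
  moreover have "holomorphic2_on f \<Omega>" using assms(7) by (simp add: bergman_space_def)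
  ultimately show ?thesis using constant_if_taylor2_eq_0 by blast
qed

end
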